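(* The closed linear span in $H^1$ of the Haar system $\{H_I : I \text{ a dyadic interval of } \mathbb{R}\}$ is $$H^A=\Big\{f\in H^1:\int_0^{\infty}f(x)\,dx=0\Big\}.$$
   Context: All functions are on $\mathbb{R}$. An atom with defining interval $I$ (a bounded interval) is a function $a$ with $\operatorname{supp}(a)\subseteq I$, $|a(x)|\le 1/|I|$ and $\int_I a(x)\,dx=0$. $H^1=H^1(\mathbb{R})$ is the Banach space of all $f=\sum_{j=1}^\infty\lambda_j a_j$ (convergence in $L^1$ and in the sense of distributions) with $a_j$ atoms and $\sum_j|\lambda_j|<\infty$, normed by $\|f\|_{H^1}=\inf\sum_j|\lambda_j|$, the infimum being over all such decompositions of $f$. A dyadic interval is an interval $I=[k2^n,(k+1)2^n)$ with $k,n\in\mathbb{Z}$; $I_L$ and $I_R$ denote its left and right halves. The $H^1$-normalized Haar function of $I$ is $H_I=\frac{1}{|I|}\chi_{I_L}-\frac{1}{|I|}\chi_{I_R}$. *)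

theory Defs
  imports "HOL-Analysis.Analysis" "HOL-Library.Function_Algebras"
begin

text \<open>Functions on the line are real valued. The spaces of the paper consist of classes of
  functions modulo equality almost everywhere; here \<open>H\<^sup>1\<close> is the set of their Borel
  representatives and its norm is a seminorm vanishing exactly on the null functions. \<open>H\<^sup>1\<close>, its
  subspace \<open>H\<^sup>A\<close> and closures in the seminorm contain with a function all its Borel modifications
  on null sets, so equality of such sets is equality of the corresponding sets of classes.\<close>

instantiation "fun" :: (type, real_vector) real_vector
begin

definition scaleR_fun :: "real \<Rightarrow> ('a \<Rightarrow> 'b) \<Rightarrow> 'a \<Rightarrow> 'b" where
  "scaleR_fun c f = (\<lambda>x. c *\<^sub>R f x)"

instance
  by standard (auto simp: scaleR_fun_def fun_eq_iff algebra_simps)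

end

definition interval_length :: "real set \<Rightarrow> real" where
  "interval_length I = measure lborel I"

text \<open>Defining intervals are bounded and nondegenerate, with or without their endpoints.\<close>

definition atom_on :: "real set \<Rightarrow> (real \<Rightarrow> real) \<Rightarrow> bool" where
  "atom_on I a \<longleftrightarrow>
     is_interval I \<and> bounded I \<and> interval_length I > 0 \<and>
     a \<in> borel_measurable borel \<and>
     {x. a x \<noteq> 0} \<subseteq> I \<and>
     (\<forall>x. \<bar>a x\<bar> \<le> 1 / interval_length I) \<and>
     (LBINT x:I. a x) = 0"

definition is_atom :: "(real \<Rightarrow> real) \<Rightarrow> bool" where
  "is_atom a \<longleftrightarrow> (\<exists>I. atom_on I a)"

definition test_function :: "(real \<Rightarrow> real) \<Rightarrow> bool" where
  "test_function \<phi> \<longleftrightarrow>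
     (\<forall>k. (deriv ^^ k) \<phi> differentiable_on UNIV) \<and> compact (closure {x. \<phi> x \<noteq> 0})"

definition atomic_decomposition ::
    "(real \<Rightarrow> real) \<Rightarrow> (nat \<Rightarrow> real) \<Rightarrow> (nat \<Rightarrow> real \<Rightarrow> real) \<Rightarrow> bool" where
  "atomic_decomposition f l a \<longleftrightarrow>
     (\<forall>j. is_atom (a j)) \<and> summable (\<lambda>j. \<bar>l j\<bar>) \<and>
     (\<lambda>n. LBINT x. \<bar>f x - (\<Sum>j<n. l j * a j x)\<bar>) \<longlonglongrightarrow> 0 \<and>
     (\<forall>\<phi>. test_function \<phi> \<longrightarrow>
        (\<lambda>n. LBINT x. (\<Sum>j<n. l j * a j x) * \<phi> x) \<longlonglongrightarrow> (LBINT x. f x * \<phi> x))"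

definition H1 :: "(real \<Rightarrow> real) set" where
  "H1 = {f. integrable lborel f \<and> (\<exists>l a. atomic_decomposition f l a)}"

definition H1_norm :: "(real \<Rightarrow> real) \<Rightarrow> real" where
  "H1_norm f = Inf {\<Sum>j. \<bar>l j\<bar> |l. \<exists>a. atomic_decomposition f l a}"

text \<open>The intersection with \<open>H\<^sup>1\<close> only keeps \<open>H1_norm\<close> away from functions without an atomic
  decomposition; it is redundant for spans of subsets of \<open>H\<^sup>1\<close>.\<close>

definition H1_closure :: "(real \<Rightarrow> real) set \<Rightarrow> (real \<Rightarrow> real) set" where
  "H1_closure S = {f \<in> H1. \<forall>e>0. \<exists>g \<in> S \<inter> H1. H1_norm (f - g) < e}"

definition dyadic_intervals :: "real set set" where
  "dyadic_intervals =
     {{of_int k * 2 powi n ..< (of_int k + 1) * 2 powi n} |k n :: int. True}"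

text \<open>The halves are meant for bounded nonempty intervals closed on the left and open on the
  right.\<close>

definition left_half :: "real set \<Rightarrow> real set" where
  "left_half I = {Inf I ..< (Inf I + Sup I) / 2}"

definition right_half :: "real set \<Rightarrow> real set" where
  "right_half I = {(Inf I + Sup I) / 2 ..< Sup I}"

definition haar :: "real set \<Rightarrow> real \<Rightarrow> real" where
  "haar I = (\<lambda>x. 1 / interval_length I * indicator (left_half I) x
               - 1 / interval_length I * indicator (right_half I) x)"

definition haar_system :: "(real \<Rightarrow> real) set" where
  "haar_system = haar ` dyadic_intervals"

definition HA :: "(real \<Rightarrow> real) set" where
  "HA = {f \<in> H1. (LBINT x:{0..}. f x) = 0}"

lemma haar_in_H1:
  assumes "I \<in> dyadic_intervals"
  shows "haar I \<in> H1"
proof -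
  obtain k n :: int where I: "I = {of_int k * 2 powi n ..< (of_int k + 1) * 2 powi n}"
    using assms by (auto simp: dyadic_intervals_def)
  define u v :: real where "u = of_int k * 2 powi n" and "v = (of_int k + 1) * 2 powi n"
  have uv: "u < v" by (simp add: u_def v_def)
  have I': "I = {u..<v}" by (simp add: I u_def v_def)
  define m where "m = (u + v) / 2"
  have m: "u < m" "m < v" "v - m = m - u" using uv by (auto simp: m_def field_simps)
  have len: "interval_length I = v - u" using uv by (simp add: I' interval_length_def)
  have halves: "left_half I = {u..<m}" "right_half I = {m..<v}"
    using uv by (auto simp: I' left_half_def right_half_def m_def)
  have H: "haar I = (\<lambda>x. 1 / (v-u) * indicator {u..<m} x - 1 / (v-u) * indicator {m..<v} x)"
    by (simp add: haar_def len halves)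
  have int: "integrable lborel (haar I)"
    unfolding H using m
    by (intro Bochner_Integration.integrable_diff integrable_mult_right integrable_real_indicator) auto
  have zero: "(LBINT x. haar I x) = 0"
    unfolding H using m
    by (subst Bochner_Integration.integral_diff)
       (auto intro!: integrable_mult_right integrable_real_indicator)
  have supp: "haar I x = 0" if "x \<notin> I" for x
  proof -
    have "x \<notin> {u..<m}" "x \<notin> {m..<v}" using that m(1,2) unfolding I' by auto
    then show ?thesis by (simp add: H)
  qed
  have bound: "\<bar>haar I x\<bar> \<le> 1 / (v - u)" for x
    using uv unfolding H by (auto simp: indicator_def)
  have "(LBINT x:I. haar I x) = (LBINT x. haar I x)"
    unfolding set_lebesgue_integral_def
  proof (rule Bochner_Integration.integral_cong[OF refl])
    show "indicator I x *\<^sub>R haar I x = haar I x" for x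
      by (cases "x \<in> I") (auto simp: supp)
  qed
  moreover have "is_interval I" "bounded I" by (simp_all add: I')
  moreover have "haar I \<in> borel_measurable borel"
    using borel_measurable_integrable[OF int] by simp
  moreover have "{x. haar I x \<noteq> 0} \<subseteq> I" using supp by blast
  ultimately have "atom_on I (haar I)"
    unfolding atom_on_def len using zero uv bound by simp
  then have atom: "is_atom (haar I)" by (auto simp: is_atom_def)
  define l :: "nat \<Rightarrow> real" where "l = (\<lambda>j. if j = 0 then 1 else 0)"
  have s: "(\<Sum>j<n. l j * haar I x) = haar I x" if "n > 0" for n x
    using that by (simp add: l_def if_distrib if_distribR sum.delta cong: if_cong)
  have ev: "eventually (\<lambda>n::nat. n > 0) sequentially"
    by (rule eventually_gt_at_top)
  have "atomic_decomposition (haar I) l (\<lambda>_. haar I)"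
    unfolding atomic_decomposition_def
  proof (intro conjI allI impI)
    show "is_atom (haar I)" by (fact atom)
    show "summable (\<lambda>j. \<bar>l j\<bar>)"
      by (rule summable_finite[of "{0}"]) (auto simp: l_def)
    show "(\<lambda>n. LBINT x. \<bar>haar I x - (\<Sum>j<n. l j * haar I x)\<bar>) \<longlonglongrightarrow> 0"
      by (rule tendsto_eventually, rule eventually_mono[OF ev]) (simp add: s)
    show "(\<lambda>n. LBINT x. (\<Sum>j<n. l j * haar I x) * \<phi> x) \<longlonglongrightarrow> (LBINT x. haar I x * \<phi> x)" for \<phi>
      by (rule tendsto_eventually, rule eventually_mono[OF ev]) (simp add: s)
  qed
  then show ?thesis using int by (auto simp: H1_def)
qed

end

theory Submission
  imports Defs
begin

text \<open>The atomic seminorm dominates the \<open>L\<^sup>1\<close> norm, so the integral over the positive half-line is a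
  continuous functional on \<open>H\<^sup>1\<close>. It vanishes on every Haar function, since a dyadic interval lies
  on one side of the origin and a Haar function has mean zero. This gives one inclusion.

  For the other inclusion let \<open>f\<close> be a sum of multiples of atoms whose integral over the positive
  half-line is zero. Subtract from each atom the multiple of \<open>odd_step\<close> with the same integral over
  that half-line. The partial sums of the corrected series still converge to \<open>f\<close> in \<open>H\<^sup>1\<close>, because
  the total correction of a partial sum is its integral over the half-line, which tends to zero. So
  it suffices that corrected atoms lie in the closed span. Such a function is the sum of two bounded
  functions of mean zero, each supported in a dyadic interval \<open>I\<close> with endpoint zero.

  Let \<open>h\<close> be bounded with mean zero and supported in a dyadic interval \<open>I\<close>. Uniform approximation by
  simple functions reduces \<open>h\<close> to a centered indicator \<open>1\<^sub>E - (|E| / |I|) 1\<^sub>I\<close>. Choose a finite union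
  \<open>V\<close> of dyadic subintervals of \<open>I\<close> close to \<open>E\<close> in measure. The centered indicator of \<open>V\<close> is a
  finite combination of Haar functions (\<open>centered_cell_in_span\<close>). The difference \<open>1\<^sub>E - 1\<^sub>V\<close> is bounded
  by one and lives on a set of small measure, but this does not make it a small multiple of an atom.
  The estimate of its norm is the heart of the proof (\<open>H1_norm_small_support\<close>). Cover the set where
  it lives by an open set \<open>U\<close> with \<open>|U \<inter> I| \<le> \<delta>\<close>, and take the maximal dyadic subintervals \<open>K\<close> of
  \<open>I\<close> on which the density of \<open>U\<close> exceeds a threshold \<open>\<theta>\<close>. Subtracting the means over the intervals
  \<open>K\<close> leaves a sum of multiples of atoms with coefficients \<open>2 |K|\<close>, of total at most \<open>2 \<delta> / \<theta>\<close>.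
  The means themselves are at most \<open>2 \<theta>\<close> in absolute value, so after centering they form a multiple of an atom on \<open>I\<close>
  with coefficient at most \<open>3 \<theta> |I|\<close>. Both terms become small when first \<open>\<theta>\<close> and then \<open>\<delta>\<close> is chosen
  small.\<close>

section \<open>Functions and limits\<close>

lemma scaleR_fun_apply [simp]: "(c *\<^sub>R f) x = c *\<^sub>R f x"
  for f :: "'a \<Rightarrow> 'b::real_vector"
  by (simp add: scaleR_fun_def)

lemma sum_fun_apply: "(\<Sum>i\<in>S. F i) x = (\<Sum>i\<in>S. F i x)"
  for F :: "'i \<Rightarrow> 'a \<Rightarrow> 'b::real_vector"
  by (induction S rule: infinite_finite_induct) auto

lemma fun_minus_eq_add_scaleR: "f - g = f + (-1) *\<^sub>R g"
  for f g :: "'a \<Rightarrow> real"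
  by (auto simp: fun_eq_iff)

lemma null_comparison:
  fixes r s :: "nat \<Rightarrow> real"
  assumes "s \<longlonglongrightarrow> 0" "\<And>n. \<bar>r n\<bar> \<le> s n"
  shows "r \<longlonglongrightarrow> 0"
  by (rule Lim_null_comparison[OF _ assms(1)]) (simp add: assms(2))

section \<open>Atoms\<close>

lemma integrable_bounded_support:
  fixes u :: "real \<Rightarrow> real"
  assumes u: "u \<in> borel_measurable borel" and S: "S \<in> sets borel" "bounded S"
    and supp: "\<And>x. x \<notin> S \<Longrightarrow> u x = 0" and bd: "\<And>x. \<bar>u x\<bar> \<le> C"
  shows "integrable lborel u"
proof (rule integrableI_bounded_set[where A = S and B = C])
  show "emeasure lborel S < \<infinity>" using emeasure_bounded_finite[OF S(2)] by simp
qed (use assms in auto)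

lemma integral_abs_bounded_support:
  fixes u :: "real \<Rightarrow> real"
  assumes u: "u \<in> borel_measurable borel" and S: "S \<in> sets borel" "bounded S"
    and supp: "\<And>x. x \<notin> S \<Longrightarrow> u x = 0" and bd: "\<And>x. \<bar>u x\<bar> \<le> C"
  shows "(LBINT x. \<bar>u x\<bar>) \<le> C * measure lborel S"
proof -
  have fin: "emeasure lborel S < \<infinity>" using emeasure_bounded_finite[OF S(2)] by simp
  have "(LBINT x. \<bar>u x\<bar>) \<le> (LBINT x. C * indicator S x)"
  proof (rule integral_mono)
    show "integrable lborel (\<lambda>x. \<bar>u x\<bar>)"
      using integrable_bounded_support[OF assms] by auto
    show "integrable lborel (\<lambda>x. C * indicator S x)"
      using S(1) fin by (intro integrable_mult_right integrable_real_indicator) auto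
    show "\<bar>u x\<bar> \<le> C * indicator S x" for x
      using bd[of x] supp[of x] by (auto simp: indicator_def)
  qed
  then show ?thesis by simp
qed

lemma atom_on_integral:
  assumes "atom_on I a"
  shows "integrable lborel a" "(LBINT x. a x) = 0" "(LBINT x. \<bar>a x\<bar>) \<le> 1"
proof -
  have I: "is_interval I" "bounded I" "interval_length I > 0" "a \<in> borel_measurable borel"
    and supp: "\<And>x. x \<notin> I \<Longrightarrow> a x = 0" and bd: "\<And>x. \<bar>a x\<bar> \<le> 1 / interval_length I"
    and zero: "(LBINT x:I. a x) = 0"
    using assms by (auto simp: atom_on_def)
  have Ib: "I \<in> sets borel" using I(1) by (rule real_interval_borel_measurable)
  show "integrable lborel a"
    using integrable_bounded_support[OF I(4) Ib I(2) supp bd] .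
  have "(\<lambda>x. indicator I x *\<^sub>R a x) = a"
    using supp by (auto simp: fun_eq_iff indicator_def)
  then show "(LBINT x. a x) = 0" using zero by (simp add: set_lebesgue_integral_def)
  show "(LBINT x. \<bar>a x\<bar>) \<le> 1"
    using integral_abs_bounded_support[OF I(4) Ib I(2) supp bd] I(3)
    by (simp add: interval_length_def)
qed

lemma atom_integrable: "is_atom a \<Longrightarrow> integrable lborel a"
  and atom_integral: "is_atom a \<Longrightarrow> (LBINT x. a x) = 0"
  and atom_integral_abs: "is_atom a \<Longrightarrow> (LBINT x. \<bar>a x\<bar>) \<le> 1"
  using atom_on_integral by (auto simp: is_atom_def)

text \<open>The case \<open>C = 0\<close>, where the divisor vanishes, needs no exception: then \<open>u\<close> is zero.\<close>

lemma atom_on_normalized: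
  fixes u :: "real \<Rightarrow> real"
  assumes I: "is_interval I" "bounded I" "measure lborel I > 0"
    and u: "u \<in> borel_measurable borel" "\<And>x. x \<notin> I \<Longrightarrow> u x = 0" "\<And>x. \<bar>u x\<bar> \<le> C"
    and zero: "(LBINT x. u x) = 0"
  shows "atom_on I (\<lambda>x. u x / (C * measure lborel I))"
    and "u x = (C * measure lborel I) * (u x / (C * measure lborel I))"
proof -
  have C: "C \<ge> 0" using u(3)[of 0] by linarith
  let ?a = "\<lambda>x. u x / (C * measure lborel I)"
  have "\<bar>?a x\<bar> \<le> 1 / measure lborel I" for x
  proof (cases "C = 0")
    case False
    then have "\<bar>u x\<bar> / C \<le> 1" using u(3)[of x] C by (simp add: field_simps)
    then have "\<bar>u x\<bar> / C / measure lborel I \<le> 1 / measure lborel I"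
      using I(3) by (intro divide_right_mono) auto
    then show ?thesis using C I(3) by (simp add: abs_mult)
  qed (use I in simp)
  moreover have "(LBINT x:I. ?a x) = (LBINT x. ?a x)"
    unfolding set_lebesgue_integral_def
    by (rule Bochner_Integration.integral_cong) (use u(2) in \<open>auto simp: indicator_def\<close>)
  moreover have "(LBINT x. ?a x) = 0" using zero by simp
  moreover have "{x. ?a x \<noteq> 0} \<subseteq> I" using u(2) by force
  moreover have "?a \<in> borel_measurable borel" using u(1) by measurable
  ultimately show "atom_on I ?a"
    using I by (auto simp: atom_on_def interval_length_def)
  show "u x = (C * measure lborel I) * (u x / (C * measure lborel I))"
    using u(3)[of x] I(3) by (cases "C = 0") auto
qed

lemma zero_is_atom: "is_atom (\<lambda>x. 0)"
  unfolding is_atom_def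
  by (rule exI[of _ "{0..1}"]) (auto simp: atom_on_def interval_length_def set_lebesgue_integral_def)

section \<open>Elementary properties of the atomic seminorm\<close>

lemma test_function_bounded:
  assumes "test_function \<phi>"
  obtains B where "\<phi> \<in> borel_measurable borel" "B \<ge> 0" "\<And>x. \<bar>\<phi> x\<bar> \<le> B"
proof -
  have "((deriv ^^ 0) \<phi>) differentiable_on UNIV" using assms unfolding test_function_def by blast
  then have c: "continuous_on UNIV \<phi>" by (simp add: differentiable_imp_continuous_on)
  let ?S = "closure {x. \<phi> x \<noteq> 0}"
  have "compact (\<phi> ` ?S)"
    using assms c unfolding test_function_def
    by (meson compact_continuous_image continuous_on_subset subset_UNIV)
  then obtain B where B: "\<And>y. y \<in> \<phi> ` ?S \<Longrightarrow> \<bar>y\<bar> \<le> B"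
    using compact_imp_bounded bounded_iff by (metis real_norm_def)
  have "\<bar>\<phi> x\<bar> \<le> max B 0" for x
  proof (cases "\<phi> x = 0")
    case False
    then have "x \<in> ?S" by (intro subsetD[OF closure_subset]) simp
    then have "\<bar>\<phi> x\<bar> \<le> B" using B by blast
    then show ?thesis by simp
  qed simp
  then show ?thesis using that[of "max B 0"] borel_measurable_continuous_onI[OF c] by auto
qed

text \<open>Test functions are bounded, so convergence in the sense of distributions is implied by
  convergence in the mean.\<close>

lemma atomic_decompositionI:
  assumes f: "integrable lborel f" and at: "\<And>j. is_atom (a j)" and l: "summable (\<lambda>j. \<bar>l j\<bar>)"
    and lim: "(\<lambda>n. LBINT x. \<bar>f x - (\<Sum>j<n. l j * a j x)\<bar>) \<longlonglongrightarrow> 0"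
  shows "atomic_decomposition f l a"
  unfolding atomic_decomposition_def
proof (intro conjI allI impI at l lim)
  fix \<phi> assume "test_function \<phi>"
  then obtain B where [measurable]: "\<phi> \<in> borel_measurable borel" and B: "B \<ge> 0" "\<And>x. \<bar>\<phi> x\<bar> \<le> B"
    using test_function_bounded by blast
  define S where "S n x = (\<Sum>j<n. l j * a j x)" for n x
  have S: "integrable lborel (S n)" for n
    unfolding S_def using atom_integrable[OF at] by (intro Bochner_Integration.integrable_sum) auto
  have prod: "integrable lborel (\<lambda>x. g x * \<phi> x)" if g: "integrable lborel g" for g
  proof (rule Bochner_Integration.integrable_bound[where f = "\<lambda>x. B * g x"])
    show "integrable lborel (\<lambda>x. B * g x)" using g by simp
    have [measurable]: "g \<in> borel_measurable borel" using borel_measurable_integrable[OF g] by simp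
    show "(\<lambda>x. g x * \<phi> x) \<in> borel_measurable lborel" by measurable
    show "AE x in lborel. norm (g x * \<phi> x) \<le> norm (B * g x)"
    proof (rule AE_I2)
      show "norm (g x * \<phi> x) \<le> norm (B * g x)" for x
        using B(1) mult_right_mono[OF B(2)[of x], of "\<bar>g x\<bar>"] by (simp add: abs_mult mult.commute)
    qed
  qed
  have bound: "\<bar>(LBINT x. S n x * \<phi> x) - (LBINT x. f x * \<phi> x)\<bar> \<le> B * (LBINT x. \<bar>f x - S n x\<bar>)" for n
  proof -
    have d: "integrable lborel (\<lambda>x. S n x - f x)" using S f by auto
    have "(LBINT x. S n x * \<phi> x) - (LBINT x. f x * \<phi> x) = (LBINT x. (S n x - f x) * \<phi> x)"
      by (subst Bochner_Integration.integral_diff[symmetric])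
         (auto intro!: prod S f simp: left_diff_distrib)
    also have "\<bar>\<dots>\<bar> \<le> (LBINT x. \<bar>(S n x - f x) * \<phi> x\<bar>)" by (rule integral_abs_bound)
    also have "\<dots> \<le> (LBINT x. B * \<bar>f x - S n x\<bar>)"
    proof (rule integral_mono)
      show "integrable lborel (\<lambda>x. \<bar>(S n x - f x) * \<phi> x\<bar>)" using prod[OF d] by auto
      show "integrable lborel (\<lambda>x. B * \<bar>f x - S n x\<bar>)"
        using S f by (intro integrable_mult_right integrable_abs Bochner_Integration.integrable_diff) auto
      show "\<bar>(S n x - f x) * \<phi> x\<bar> \<le> B * \<bar>f x - S n x\<bar>" for x
        using mult_right_mono[OF B(2)[of x], of "\<bar>f x - S n x\<bar>"]
        by (simp add: abs_mult abs_minus_commute mult.commute)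
    qed
    finally show ?thesis by simp
  qed
  have "(\<lambda>n. B * (LBINT x. \<bar>f x - S n x\<bar>)) \<longlonglongrightarrow> B * 0"
    using lim unfolding S_def by (intro tendsto_mult_left)
  then have "(\<lambda>n. (LBINT x. S n x * \<phi> x) - (LBINT x. f x * \<phi> x)) \<longlonglongrightarrow> 0"
    by (intro null_comparison[OF _ bound]) simp
  then show "(\<lambda>n. LBINT x. (\<Sum>j<n. l j * a j x) * \<phi> x) \<longlonglongrightarrow> (LBINT x. f x * \<phi> x)"
    unfolding S_def by (simp add: LIM_zero_iff)
qed

lemma atomic_decompositionD:
  assumes "atomic_decomposition f l a"
  shows "is_atom (a j)" "summable (\<lambda>j. \<bar>l j\<bar>)"
    "(\<lambda>n. LBINT x. \<bar>f x - (\<Sum>j<n. l j * a j x)\<bar>) \<longlonglongrightarrow> 0"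
  using assms by (auto simp: atomic_decomposition_def)

lemma partial_sum_integrable:
  assumes "\<And>j. is_atom (a j)"
  shows "integrable lborel (\<lambda>x. \<Sum>j<n. l j * a j x)"
  using atom_integrable[OF assms] by (intro Bochner_Integration.integrable_sum) auto

lemma H1_integrable: "f \<in> H1 \<Longrightarrow> integrable lborel f"
  by (simp add: H1_def)

lemma H1_measurable: "f \<in> H1 \<Longrightarrow> f \<in> borel_measurable borel"
  using borel_measurable_integrable[OF H1_integrable] by simp

lemma H1I: "integrable lborel f \<Longrightarrow> atomic_decomposition f l a \<Longrightarrow> f \<in> H1"
  by (auto simp: H1_def)

lemma H1_norm_le:
  assumes "atomic_decomposition f l a"
  shows "H1_norm f \<le> (\<Sum>j. \<bar>l j\<bar>)"
  unfolding H1_norm_def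
proof (rule cInf_lower)
  show "bdd_below {\<Sum>j. \<bar>l j\<bar> |l. \<exists>a. atomic_decomposition f l a}"
    by (rule bdd_belowI[of _ 0]) (auto intro!: suminf_nonneg dest: atomic_decompositionD)
qed (use assms in auto)

lemma H1_norm_approx:
  assumes "f \<in> H1" "e > 0"
  obtains l a where "atomic_decomposition f l a" "(\<Sum>j. \<bar>l j\<bar>) < H1_norm f + e"
proof -
  let ?X = "{\<Sum>j. \<bar>l j\<bar> |l. \<exists>a. atomic_decomposition f l a}"
  have "?X \<noteq> {}" using assms by (auto simp: H1_def)
  moreover have "Inf ?X < H1_norm f + e" using assms by (simp add: H1_norm_def)
  ultimately obtain y where "y \<in> ?X" "y < H1_norm f + e"
    by (rule cInf_lessD[THEN bexE])
  then show ?thesis using that by auto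
qed

lemma H1_norm_nonneg:
  assumes "f \<in> H1"
  shows "H1_norm f \<ge> 0"
proof (rule field_le_epsilon)
  fix e :: real assume "e > 0"
  then obtain l a where *: "atomic_decomposition f l a" "(\<Sum>j. \<bar>l j\<bar>) < H1_norm f + e"
    using H1_norm_approx assms by blast
  have "(\<Sum>j. \<bar>l j\<bar>) \<ge> 0" using atomic_decompositionD(2)[OF *(1)] by (intro suminf_nonneg) auto
  then show "0 \<le> H1_norm f + e" using * by linarith
qed

lemma H1_scaleR:
  assumes f: "f \<in> H1"
  shows "c *\<^sub>R f \<in> H1" "H1_norm (c *\<^sub>R f) \<le> \<bar>c\<bar> * H1_norm f"
proof -
  have i: "integrable lborel (c *\<^sub>R f)" using H1_integrable[OF f] by (simp add: scaleR_fun_def)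
  have d: "atomic_decomposition (c *\<^sub>R f) (\<lambda>j. c * l j) a" if d: "atomic_decomposition f l a" for l a
  proof (rule atomic_decompositionI[OF i])
    show "is_atom (a j)" for j using atomic_decompositionD(1)[OF d] .
    show "summable (\<lambda>j. \<bar>c * l j\<bar>)"
      using atomic_decompositionD(2)[OF d] by (simp add: abs_mult summable_mult)
    have "\<bar>(c *\<^sub>R f) x - (\<Sum>j<n. c * l j * a j x)\<bar> = \<bar>c\<bar> * \<bar>f x - (\<Sum>j<n. l j * a j x)\<bar>" for n x
      by (simp add: abs_mult[symmetric] right_diff_distrib sum_distrib_left mult.assoc)
    moreover have "(\<lambda>n. \<bar>c\<bar> * (LBINT x. \<bar>f x - (\<Sum>j<n. l j * a j x)\<bar>)) \<longlonglongrightarrow> \<bar>c\<bar> * 0"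
      using atomic_decompositionD(3)[OF d] by (rule tendsto_mult_left)
    ultimately show "(\<lambda>n. LBINT x. \<bar>(c *\<^sub>R f) x - (\<Sum>j<n. c * l j * a j x)\<bar>) \<longlonglongrightarrow> 0"
      by simp
  qed
  from f obtain l a where "atomic_decomposition f l a" by (auto simp: H1_def)
  from d[OF this] i show "c *\<^sub>R f \<in> H1" by (auto simp: H1_def)
  show "H1_norm (c *\<^sub>R f) \<le> \<bar>c\<bar> * H1_norm f"
  proof (rule field_le_epsilon)
    fix e :: real assume e: "e > 0"
    then have "e / (\<bar>c\<bar> + 1) > 0" by (simp add: add_nonneg_pos)
    then obtain l a where *: "atomic_decomposition f l a" "(\<Sum>j. \<bar>l j\<bar>) < H1_norm f + e / (\<bar>c\<bar> + 1)"
      using H1_norm_approx f by blast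
    have "H1_norm (c *\<^sub>R f) \<le> (\<Sum>j. \<bar>c * l j\<bar>)" using d[OF *(1)] by (rule H1_norm_le)
    also have "\<dots> = \<bar>c\<bar> * (\<Sum>j. \<bar>l j\<bar>)"
      using atomic_decompositionD(2)[OF *(1)] by (simp add: abs_mult suminf_mult)
    also have "\<dots> \<le> \<bar>c\<bar> * (H1_norm f + e / (\<bar>c\<bar> + 1))" using *(2) by (intro mult_left_mono) auto
    also have "\<dots> \<le> \<bar>c\<bar> * H1_norm f + e" using e by (simp add: field_simps)
    finally show "H1_norm (c *\<^sub>R f) \<le> \<bar>c\<bar> * H1_norm f + e" .
  qed
qed

lemma sum_interlace:
  fixes p q :: "nat \<Rightarrow> real"
  shows "(\<Sum>j<n. if even j then p (j div 2) else q (j div 2))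
    = (\<Sum>j<(n + 1) div 2. p j) + (\<Sum>j<n div 2. q j)"
  by (induction n) (auto elim!: evenE oddE)

text \<open>The decompositions of the summands are interlaced, one on the even and one on the odd
  indices.\<close>

lemma H1_add:
  assumes f: "f \<in> H1" and g: "g \<in> H1"
  shows "f + g \<in> H1" "H1_norm (f + g) \<le> H1_norm f + H1_norm g"
proof -
  have i: "integrable lborel (f + g)"
    using H1_integrable[OF f] H1_integrable[OF g] by (simp add: plus_fun_def)
  have d: "\<exists>k c. atomic_decomposition (f + g) k c \<and> (\<Sum>j. \<bar>k j\<bar>) \<le> (\<Sum>j. \<bar>l j\<bar>) + (\<Sum>j. \<bar>m j\<bar>)"
    if df: "atomic_decomposition f l a" and dg: "atomic_decomposition g m b" for l a m b
  proof -
    define k where "k j = (if even j then l (j div 2) else m (j div 2))" for j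
    define c where "c j = (if even j then a (j div 2) else b (j div 2))" for j
    have at: "is_atom (c j)" for j
      using atomic_decompositionD(1)[OF df] atomic_decompositionD(1)[OF dg] by (simp add: c_def)
    have kabs: "(\<Sum>j<n. \<bar>k j\<bar>) = (\<Sum>j<(n + 1) div 2. \<bar>l j\<bar>) + (\<Sum>j<n div 2. \<bar>m j\<bar>)" for n
      using sum_interlace[of "\<lambda>j. \<bar>l j\<bar>" "\<lambda>j. \<bar>m j\<bar>" n] by (simp add: k_def if_distrib cong: if_cong)
    have le: "(\<Sum>j<n. \<bar>k j\<bar>) \<le> (\<Sum>j. \<bar>l j\<bar>) + (\<Sum>j. \<bar>m j\<bar>)" for n
      unfolding kabs using atomic_decompositionD(2)[OF df] atomic_decompositionD(2)[OF dg]
      by (intro add_mono sum_le_suminf) auto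
    have sk: "summable (\<lambda>j. \<bar>k j\<bar>)" by (rule summableI_nonneg_bounded[OF _ le]) simp
    define A where "A n = (LBINT x. \<bar>f x - (\<Sum>j<n. l j * a j x)\<bar>)" for n
    define B where "B n = (LBINT x. \<bar>g x - (\<Sum>j<n. m j * b j x)\<bar>)" for n
    have fl: "filterlim (\<lambda>n. (n + 1) div 2) sequentially sequentially"
      "filterlim (\<lambda>n::nat. n div 2) sequentially sequentially"
    proof -
      have "2 * Z \<le> n \<Longrightarrow> Z \<le> n div 2 \<and> Z \<le> (n + 1) div 2" for Z n :: nat by linarith
      then show "filterlim (\<lambda>n. (n + 1) div 2) sequentially sequentially"
        "filterlim (\<lambda>n::nat. n div 2) sequentially sequentially"
        unfolding filterlim_at_top eventually_sequentially by blast+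
    qed
    have lim: "(\<lambda>n. A ((n + 1) div 2) + B (n div 2)) \<longlonglongrightarrow> 0 + 0"
      using atomic_decompositionD(3)[OF df] atomic_decompositionD(3)[OF dg]
      unfolding A_def[symmetric] B_def[symmetric]
      by (intro tendsto_add filterlim_compose[OF _ fl(1)] filterlim_compose[OF _ fl(2)])
    have bound: "(LBINT x. \<bar>(f + g) x - (\<Sum>j<n. k j * c j x)\<bar>) \<le> A ((n + 1) div 2) + B (n div 2)" for n
    proof -
      let ?p = "\<lambda>x. f x - (\<Sum>j<(n + 1) div 2. l j * a j x)" and ?q = "\<lambda>x. g x - (\<Sum>j<n div 2. m j * b j x)"
      have ip: "integrable lborel ?p"
        by (intro Bochner_Integration.integrable_diff H1_integrable f partial_sum_integrable
            atomic_decompositionD(1)[OF df])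
      have iq: "integrable lborel ?q"
        by (intro Bochner_Integration.integrable_diff H1_integrable g partial_sum_integrable
            atomic_decompositionD(1)[OF dg])
      have eq: "(f + g) x - (\<Sum>j<n. k j * c j x) = ?p x + ?q x" for x
      proof -
        have "(\<Sum>j<n. k j * c j x) =
          (\<Sum>j<n. if even j then l (j div 2) * a (j div 2) x else m (j div 2) * b (j div 2) x)"
          by (rule sum.cong) (auto simp: k_def c_def)
        then show ?thesis
          using sum_interlace[of "\<lambda>j. l j * a j x" "\<lambda>j. m j * b j x" n] by simp
      qed
      have "(LBINT x. \<bar>(f + g) x - (\<Sum>j<n. k j * c j x)\<bar>) = (LBINT x. \<bar>?p x + ?q x\<bar>)"
        unfolding eq ..
      also have "\<dots> \<le> (LBINT x. \<bar>?p x\<bar> + \<bar>?q x\<bar>)"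
        using ip iq by (intro integral_mono) auto
      also have "\<dots> = A ((n + 1) div 2) + B (n div 2)"
        unfolding A_def B_def using ip iq by (intro Bochner_Integration.integral_add) auto
      finally show ?thesis .
    qed
    have "(\<lambda>n. LBINT x. \<bar>(f + g) x - (\<Sum>j<n. k j * c j x)\<bar>) \<longlonglongrightarrow> 0"
    proof (rule null_comparison)
      show "(\<lambda>n. A ((n + 1) div 2) + B (n div 2)) \<longlonglongrightarrow> 0" using lim by simp
    qed (use bound in simp)
    then have "atomic_decomposition (f + g) k c" by (rule atomic_decompositionI[OF i at sk])
    moreover have "(\<Sum>j. \<bar>k j\<bar>) \<le> (\<Sum>j. \<bar>l j\<bar>) + (\<Sum>j. \<bar>m j\<bar>)"
      using le sk by (intro suminf_le_const) auto
    ultimately show ?thesis by blast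
  qed
  from f g obtain l a m b where "atomic_decomposition f l a" "atomic_decomposition g m b"
    by (auto simp: H1_def)
  from d[OF this] i show "f + g \<in> H1" by (auto simp: H1_def)
  show "H1_norm (f + g) \<le> H1_norm f + H1_norm g"
  proof (rule field_le_epsilon)
    fix e :: real assume e: "e > 0"
    obtain l a where *: "atomic_decomposition f l a" "(\<Sum>j. \<bar>l j\<bar>) < H1_norm f + e / 2"
      using H1_norm_approx[OF f, of "e / 2"] e by auto
    obtain m b where **: "atomic_decomposition g m b" "(\<Sum>j. \<bar>m j\<bar>) < H1_norm g + e / 2"
      using H1_norm_approx[OF g, of "e / 2"] e by auto
    obtain k c where "atomic_decomposition (f + g) k c" "(\<Sum>j. \<bar>k j\<bar>) \<le> (\<Sum>j. \<bar>l j\<bar>) + (\<Sum>j. \<bar>m j\<bar>)"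
      using d[OF *(1) **(1)] by blast
    then show "H1_norm (f + g) \<le> H1_norm f + H1_norm g + e"
      using H1_norm_le[of "f + g" k c] * ** by simp
  qed
qed

lemma H1_diff:
  assumes "f \<in> H1" "g \<in> H1"
  shows "f - g \<in> H1" "H1_norm (f - g) \<le> H1_norm f + H1_norm g"
  unfolding fun_minus_eq_add_scaleR
  using assms H1_add[OF assms(1) H1_scaleR(1)[OF assms(2), of "-1"]] H1_scaleR(2)[OF assms(2), of "-1"]
  by auto

text \<open>An atom has \<open>L\<^sup>1\<close> norm at most one, so the \<open>L\<^sup>1\<close> norm is dominated by the atomic seminorm.
  Hence integrals over fixed sets are continuous for the atomic seminorm.\<close>

lemma H1_integral_abs_le:
  assumes f: "f \<in> H1"
  shows "(LBINT x. \<bar>f x\<bar>) \<le> H1_norm f"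
proof (rule field_le_epsilon)
  fix e :: real assume e: "e > 0"
  obtain l a where d: "atomic_decomposition f l a" and le: "(\<Sum>j. \<bar>l j\<bar>) < H1_norm f + e"
    using H1_norm_approx[OF f e] .
  note D = atomic_decompositionD[OF d]
  define r where "r n = (LBINT x. \<bar>f x - (\<Sum>j<n. l j * a j x)\<bar>)" for n
  have "(LBINT x. \<bar>f x\<bar>) \<le> r n + (\<Sum>j. \<bar>l j\<bar>)" for n
  proof -
    have ai: "integrable lborel (\<lambda>x. \<bar>l j\<bar> * \<bar>a j x\<bar>)" for j using atom_integrable[OF D(1)] by auto
    have di: "integrable lborel (\<lambda>x. \<bar>f x - (\<Sum>j<n. l j * a j x)\<bar>)"
      by (intro integrable_abs Bochner_Integration.integrable_diff H1_integrable f partial_sum_integrable D)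
    have "(LBINT x. \<bar>f x\<bar>) \<le> (LBINT x. \<bar>f x - (\<Sum>j<n. l j * a j x)\<bar> + (\<Sum>j<n. \<bar>l j\<bar> * \<bar>a j x\<bar>))"
    proof (rule integral_mono)
      show "integrable lborel (\<lambda>x. \<bar>f x\<bar>)" using H1_integrable[OF f] by auto
      show "integrable lborel (\<lambda>x. \<bar>f x - (\<Sum>j<n. l j * a j x)\<bar> + (\<Sum>j<n. \<bar>l j\<bar> * \<bar>a j x\<bar>))"
        by (intro Bochner_Integration.integrable_add Bochner_Integration.integrable_sum ai di)
      fix x
      have "\<bar>\<Sum>j<n. l j * a j x\<bar> \<le> (\<Sum>j<n. \<bar>l j\<bar> * \<bar>a j x\<bar>)"
        using sum_abs[of "\<lambda>j. l j * a j x" "{..<n}"] by (simp add: abs_mult)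
      then show "\<bar>f x\<bar> \<le> \<bar>f x - (\<Sum>j<n. l j * a j x)\<bar> + (\<Sum>j<n. \<bar>l j\<bar> * \<bar>a j x\<bar>)" by linarith
    qed
    also have "\<dots> = r n + (\<Sum>j<n. \<bar>l j\<bar> * (LBINT x. \<bar>a j x\<bar>))"
      unfolding r_def using ai di
      by (subst Bochner_Integration.integral_add) (auto intro!: Bochner_Integration.integrable_sum)
    also have "(\<Sum>j<n. \<bar>l j\<bar> * (LBINT x. \<bar>a j x\<bar>)) \<le> (\<Sum>j<n. \<bar>l j\<bar>)"
      using atom_integral_abs[OF D(1)] by (intro sum_mono) (simp add: mult_left_le)
    also have "(\<Sum>j<n. \<bar>l j\<bar>) \<le> (\<Sum>j. \<bar>l j\<bar>)" using D(2) by (intro sum_le_suminf) auto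
    finally show ?thesis by simp
  qed
  moreover have "(\<lambda>n. r n + (\<Sum>j. \<bar>l j\<bar>)) \<longlonglongrightarrow> 0 + (\<Sum>j. \<bar>l j\<bar>)"
    using D(3) unfolding r_def by (intro tendsto_add tendsto_const)
  ultimately have "(LBINT x. \<bar>f x\<bar>) \<le> 0 + (\<Sum>j. \<bar>l j\<bar>)"
    by (intro LIMSEQ_le_const) auto
  then show "(LBINT x. \<bar>f x\<bar>) \<le> H1_norm f + e" using le by simp
qed

lemma set_integral_tendsto_L1:
  fixes f :: "real \<Rightarrow> real"
  assumes f: "integrable lborel f" and g: "\<And>n. integrable lborel (g n)" and S: "S \<in> sets borel"
    and lim: "(\<lambda>n. LBINT x. \<bar>f x - g n x\<bar>) \<longlonglongrightarrow> 0"
  shows "(\<lambda>n. LBINT x:S. g n x) \<longlonglongrightarrow> (LBINT x:S. f x)"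
proof -
  have si: "set_integrable lborel S h" if "integrable lborel h" for h :: "real \<Rightarrow> real"
    unfolding set_integrable_def using that S by (intro integrable_mult_indicator) auto
  have "\<bar>(LBINT x:S. g n x) - (LBINT x:S. f x)\<bar> \<le> (LBINT x. \<bar>f x - g n x\<bar>)" for n
  proof -
    have i: "integrable lborel (\<lambda>x. g n x - f x)" using f g by auto
    have "(LBINT x:S. g n x) - (LBINT x:S. f x) = (LBINT x:S. g n x - f x)"
      using si f g by (simp add: set_integral_diff)
    also have "\<bar>\<dots>\<bar> \<le> (LBINT x. \<bar>indicator S x *\<^sub>R (g n x - f x)\<bar>)"
      unfolding set_lebesgue_integral_def by (rule integral_abs_bound)
    also have "\<dots> \<le> (LBINT x. \<bar>f x - g n x\<bar>)"
    proof (rule integral_mono)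
      show "integrable lborel (\<lambda>x. \<bar>indicator S x *\<^sub>R (g n x - f x)\<bar>)"
        using si[OF i] by (auto simp: set_integrable_def)
      show "integrable lborel (\<lambda>x. \<bar>f x - g n x\<bar>)" using f g by auto
    qed (auto simp: indicator_def)
    finally show ?thesis .
  qed
  then have "(\<lambda>n. (LBINT x:S. g n x) - (LBINT x:S. f x)) \<longlonglongrightarrow> 0"
    by (rule null_comparison[OF lim])
  then show ?thesis by (simp add: LIM_zero_iff)
qed

lemma H1_integral_zero:
  assumes f: "f \<in> H1"
  shows "(LBINT x. f x) = 0"
proof -
  obtain l a where d: "atomic_decomposition f l a" using f by (auto simp: H1_def)
  note D = atomic_decompositionD[OF d]
  have "(\<lambda>n. LBINT x:UNIV. (\<Sum>j<n. l j * a j x)) \<longlonglongrightarrow> (LBINT x:UNIV. f x)"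
    by (rule set_integral_tendsto_L1[OF H1_integrable[OF f] partial_sum_integrable _ D(3)]) (use D in auto)
  moreover have "(LBINT x. (\<Sum>j<n. l j * a j x)) = 0" for n
    using atom_integrable[OF D(1)] atom_integral[OF D(1)]
    by (subst Bochner_Integration.integral_sum) auto
  ultimately show ?thesis by (simp add: set_lebesgue_integral_def LIMSEQ_const_iff)
qed

text \<open>A bounded function with mean zero supported in an interval is a multiple of an atom.\<close>

lemma H1_bounded_support:
  fixes u :: "real \<Rightarrow> real"
  assumes I: "is_interval I" "bounded I" "measure lborel I > 0"
    and u: "u \<in> borel_measurable borel" "\<And>x. x \<notin> I \<Longrightarrow> u x = 0" "\<And>x. \<bar>u x\<bar> \<le> C"
    and zero: "(LBINT x. u x) = 0"
  shows "u \<in> H1" "H1_norm u \<le> C * measure lborel I"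
proof -
  have C: "C \<ge> 0" using u(3)[of 0] by linarith
  have i: "integrable lborel u"
    using integrable_bounded_support[OF u(1) real_interval_borel_measurable I(2) u(2,3)] I(1) by blast
  define l where "l j = (if j = 0 then C * measure lborel I else 0)" for j :: nat
  let ?a = "\<lambda>x. u x / (C * measure lborel I)"
  have l: "l sums (C * measure lborel I)"
    unfolding l_def using sums_single[of 0 "\<lambda>_. C * measure lborel I"] by simp
  have labs: "(\<lambda>j. \<bar>l j\<bar>) = l" using C by (auto simp: l_def fun_eq_iff)
  have "u x - (\<Sum>j<n. l j * ?a x) = 0" if "n > 0" for n x
  proof -
    have "(\<Sum>j<n. l j * ?a x) = (\<Sum>j<n. if j = 0 then C * measure lborel I * ?a x else 0)"
      by (rule sum.cong) (auto simp: l_def)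
    also have "\<dots> = C * measure lborel I * ?a x" using that by (simp add: sum.delta)
    also have "\<dots> = u x" using atom_on_normalized(2)[OF assms] by simp
    finally show ?thesis by simp
  qed
  then have "(\<lambda>n. LBINT x. \<bar>u x - (\<Sum>j<n. l j * ?a x)\<bar>) \<longlonglongrightarrow> 0"
    by (intro tendsto_eventually eventually_mono[OF eventually_gt_at_top[of 0]]) simp
  then have d: "atomic_decomposition u l (\<lambda>_. ?a)"
    using atom_on_normalized(1)[OF assms] l
    by (intro atomic_decompositionI i) (auto simp: is_atom_def labs sums_iff)
  from H1I[OF i d] show "u \<in> H1" .
  show "H1_norm u \<le> C * measure lborel I" using H1_norm_le[OF d] l by (simp add: labs sums_iff)
qed

text \<open>A pointwise convergent series of multiples of atoms with absolutely summable coefficients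
  converges in the mean.\<close>

lemma H1_atomic_series:
  assumes at: "\<And>j. is_atom (a j)" and l: "summable (\<lambda>j. \<bar>l j\<bar>)"
    and pt: "\<And>x. summable (\<lambda>j. \<bar>l j * a j x\<bar>)"
  shows "(\<lambda>x. \<Sum>j. l j * a j x) \<in> H1" "H1_norm (\<lambda>x. \<Sum>j. l j * a j x) \<le> (\<Sum>j. \<bar>l j\<bar>)"
proof -
  define F where "F j x = l j * a j x" for j x
  have Fi: "integrable lborel (F j)" for j
    unfolding F_def using atom_integrable[OF at] by auto
  have Fl: "(LBINT x. \<bar>F j x\<bar>) \<le> \<bar>l j\<bar>" for j
    unfolding F_def using atom_integral_abs[OF at, of j] by (simp add: abs_mult mult_left_le)
  have Fs: "summable (\<lambda>j. LBINT x. \<bar>F j x\<bar>)"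
    using Fl by (intro summable_comparison_test'[OF l, of 0]) auto
  have pt': "summable (\<lambda>j. \<bar>F (j + n) x\<bar>)" for n x
    using pt[of x] unfolding F_def by (subst summable_iff_shift)
  have Fs': "summable (\<lambda>j. LBINT x. \<bar>F (j + n) x\<bar>)" for n
    using Fs by (subst summable_iff_shift)
  have i: "integrable lborel (\<lambda>x. \<Sum>j. F j x)"
    using pt'[of 0] Fs by (intro integrable_suminf Fi) auto
  have tail: "(LBINT x. \<bar>(\<Sum>j. F j x) - (\<Sum>j<n. F j x)\<bar>) \<le> (\<Sum>j. \<bar>l (j + n)\<bar>)" for n
  proof -
    have eq: "(\<Sum>j. F j x) - (\<Sum>j<n. F j x) = (\<Sum>j. F (j + n) x)" for x
      using pt'[of 0 x] by (subst suminf_split_initial_segment[of _ n]) (auto intro: summable_rabs_cancel)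
    have "(LBINT x. \<bar>(\<Sum>j. F j x) - (\<Sum>j<n. F j x)\<bar>) = (LBINT x. \<bar>\<Sum>j. F (j + n) x\<bar>)"
      unfolding eq ..
    also have "\<dots> \<le> (LBINT x. (\<Sum>j. \<bar>F (j + n) x\<bar>))"
    proof (rule integral_mono)
      show "integrable lborel (\<lambda>x. \<bar>\<Sum>j. F (j + n) x\<bar>)"
        using pt' Fs' Fi by (intro integrable_abs integrable_suminf) auto
      show "integrable lborel (\<lambda>x. \<Sum>j. \<bar>F (j + n) x\<bar>)"
        using pt' Fs' Fi by (intro integrable_suminf integrable_abs) auto
      show "\<bar>\<Sum>j. F (j + n) x\<bar> \<le> (\<Sum>j. \<bar>F (j + n) x\<bar>)" for x by (rule summable_rabs[OF pt'])
    qed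
    also have "\<dots> = (\<Sum>j. LBINT x. \<bar>F (j + n) x\<bar>)"
      using pt' Fs' Fi by (intro integral_suminf) auto
    also have "\<dots> \<le> (\<Sum>j. \<bar>l (j + n)\<bar>)"
      by (rule suminf_le[OF Fl Fs']) (use l in \<open>subst summable_iff_shift\<close>)
    finally show ?thesis .
  qed
  have "(\<lambda>n. \<Sum>j. \<bar>l (j + n)\<bar>) \<longlonglongrightarrow> 0" using l by (rule suminf_exist_split2)
  then have "(\<lambda>n. LBINT x. \<bar>(\<Sum>j. F j x) - (\<Sum>j<n. F j x)\<bar>) \<longlonglongrightarrow> 0"
    by (rule null_comparison) (use tail in simp)
  then have d: "atomic_decomposition (\<lambda>x. \<Sum>j. F j x) l a"
    unfolding F_def using i by (intro atomic_decompositionI at l) (simp_all add: F_def)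
  from H1I[OF i d] show "(\<lambda>x. \<Sum>j. l j * a j x) \<in> H1" by (simp add: F_def)
  from H1_norm_le[OF d] show "H1_norm (\<lambda>x. \<Sum>j. l j * a j x) \<le> (\<Sum>j. \<bar>l j\<bar>)" by (simp add: F_def)
qed

section \<open>Closures of subspaces\<close>

lemma subspace_H1: "subspace H1"
proof (rule subspaceI)
  have "(\<lambda>x::real. 0::real) \<in> H1"
    by (rule H1_bounded_support[of "{0..1}" _ 0]) auto
  then show "0 \<in> H1" by (simp add: zero_fun_def)
qed (auto intro: H1_add H1_scaleR)

lemma H1_norm_zero: "H1_norm 0 = 0"
proof -
  have "H1_norm (\<lambda>x::real. 0::real) \<le> 0 * measure lborel {0..1::real}"
    by (rule H1_bounded_support[of "{0..1}" _ 0]) auto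
  then show ?thesis
    using H1_norm_nonneg[OF subspace_0[OF subspace_H1]] by (simp add: zero_fun_def)
qed

lemma H1_closure_subset: "H1_closure S \<subseteq> H1"
  by (auto simp: H1_closure_def)

lemma subspace_H1_closure:
  assumes S: "subspace S"
  shows "subspace (H1_closure S)"
proof (rule subspaceI)
  have "0 \<in> S \<inter> H1" using subspace_0[OF S] subspace_0[OF subspace_H1] by blast
  moreover have "H1_norm (0 - 0) < e" if "e > 0" for e using that H1_norm_zero by simp
  ultimately show "0 \<in> H1_closure S" unfolding H1_closure_def by blast
next
  fix f g assume f: "f \<in> H1_closure S" and g: "g \<in> H1_closure S"
  have "\<exists>h \<in> S \<inter> H1. H1_norm ((f + g) - h) < e" if "e > 0" for e
  proof -
    obtain p where p: "p \<in> S" "p \<in> H1" "H1_norm (f - p) < e / 2"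
      using f half_gt_zero[OF \<open>e > 0\<close>] unfolding H1_closure_def by blast
    obtain q where q: "q \<in> S" "q \<in> H1" "H1_norm (g - q) < e / 2"
      using g half_gt_zero[OF \<open>e > 0\<close>] unfolding H1_closure_def by blast
    have "f - p \<in> H1" "g - q \<in> H1"
      using f g p q H1_closure_subset by (auto intro!: H1_diff)
    then have "H1_norm ((f + g) - (p + q)) < e"
      unfolding add_diff_add using H1_add(2)[of "f - p" "g - q"] p(3) q(3) by linarith
    then show ?thesis using p q subspace_add[OF S] H1_add by blast
  qed
  then show "f + g \<in> H1_closure S"
    using f g H1_add unfolding H1_closure_def by blast
next
  fix c f assume f: "f \<in> H1_closure S"
  have "\<exists>h \<in> S \<inter> H1. H1_norm (c *\<^sub>R f - h) < e" if e: "e > 0" for e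
  proof -
    have "e / (\<bar>c\<bar> + 1) > 0" using e by (simp add: add_nonneg_pos)
    then obtain p where p: "p \<in> S" "p \<in> H1" "H1_norm (f - p) < e / (\<bar>c\<bar> + 1)"
      using f unfolding H1_closure_def by blast
    have fp: "f - p \<in> H1" using f p H1_closure_subset by (auto intro!: H1_diff)
    have "c *\<^sub>R f - c *\<^sub>R p = c *\<^sub>R (f - p)" by (simp add: scaleR_diff_right)
    then have "H1_norm (c *\<^sub>R f - c *\<^sub>R p) \<le> \<bar>c\<bar> * H1_norm (f - p)"
      using H1_scaleR(2)[OF fp] by simp
    also have "\<dots> \<le> \<bar>c\<bar> * (e / (\<bar>c\<bar> + 1))" using p by (intro mult_left_mono) auto
    also have "\<dots> < e" using e by (simp add: field_simps)
    finally show ?thesis using p subspace_scale[OF S] H1_scaleR by blast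
  qed
  then show "c *\<^sub>R f \<in> H1_closure S"
    using f H1_scaleR unfolding H1_closure_def by blast
qed

text \<open>The closure is closed under approximation in the atomic seminorm.\<close>

lemma H1_closure_closed:
  assumes f: "f \<in> H1" and ap: "\<And>e. e > 0 \<Longrightarrow> \<exists>h \<in> H1_closure S. H1_norm (f - h) < e"
  shows "f \<in> H1_closure S"
proof -
  have "\<exists>g \<in> S \<inter> H1. H1_norm (f - g) < e" if e: "e > 0" for e
  proof -
    obtain h where h: "h \<in> H1_closure S" "H1_norm (f - h) < e / 2" using ap[of "e / 2"] e by auto
    obtain g where g: "g \<in> S" "g \<in> H1" "H1_norm (h - g) < e / 2"
      using h(1) half_gt_zero[OF e] unfolding H1_closure_def by blast
    have hH: "h \<in> H1" using h(1) H1_closure_subset by blast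
    have eq: "f - g = (f - h) + (h - g)" by simp
    have "H1_norm (f - g) < e"
      unfolding eq using H1_add(2)[OF H1_diff(1)[OF f hH] H1_diff(1)[OF hH g(2)]] h(2) g(3) by linarith
    then show ?thesis using g by blast
  qed
  then show ?thesis using f by (simp add: H1_closure_def)
qed

lemma span_haar_subset_H1: "span haar_system \<subseteq> H1"
  by (rule span_minimal[OF _ subspace_H1]) (auto simp: haar_system_def haar_in_H1)

section \<open>Dyadic subintervals of a fixed interval\<close>

text \<open>The cell of level \<open>m\<close> and index \<open>k\<close> of the interval with left endpoint \<open>A\<close> and length \<open>L\<close>;
  for \<open>L > 0\<close> it lies in that interval exactly when \<open>k < 2 ^ m\<close>.\<close>

definition cell :: "real \<Rightarrow> real \<Rightarrow> nat \<Rightarrow> nat \<Rightarrow> real set" where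
  "cell A L m k = {A + real k * L / 2 ^ m ..< A + (real k + 1) * L / 2 ^ m}"

lemma cell_0: "cell A L 0 0 = {A..<A + L}"
  by (simp add: cell_def)

lemma measure_cell: "L > 0 \<Longrightarrow> measure lborel (cell A L m k) = L / 2 ^ m"
  by (simp add: cell_def divide_right_mono field_simps)

lemma cell_interval: "is_interval (cell A L m k)" "bounded (cell A L m k)" "cell A L m k \<in> sets borel"
  by (auto simp: cell_def is_interval_co)

lemma cell_iff:
  assumes "L > 0"
  shows "x \<in> cell A L m k \<longleftrightarrow> A \<le> x \<and> k = nat \<lfloor>(x - A) * 2 ^ m / L\<rfloor>"
proof -
  define y where "y = (x - A) * 2 ^ m / L"
  have "x \<in> cell A L m k \<longleftrightarrow> real k \<le> y \<and> y < real k + 1"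
    using assms by (auto simp: cell_def y_def field_simps)
  also have "\<dots> \<longleftrightarrow> \<lfloor>y\<rfloor> = int k" by (auto simp: floor_eq_iff)
  also have "\<dots> \<longleftrightarrow> 0 \<le> y \<and> k = nat \<lfloor>y\<rfloor>"
    by (auto simp del: zero_le_floor simp: zero_le_floor[symmetric])
  also have "0 \<le> y \<longleftrightarrow> A \<le> x"
    using mult_le_cancel_right_pos[of "2 ^ m / L" 0 "x - A"] assms by (simp add: y_def)
  finally show ?thesis unfolding y_def .
qed

lemma cell_parent:
  assumes "L > 0"
  shows "cell A L (Suc m) k \<subseteq> cell A L m (k div 2)"
proof -
  have "k div 2 * 2 \<le> k" "k + 1 \<le> (k div 2 + 1) * 2" by presburger+
  then have "real (k div 2) * 2 \<le> real k" "real k + 1 \<le> (real (k div 2) + 1) * 2"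
    by (simp_all flip: of_nat_le_iff[where ?'a = real])
  then have le: "real (k div 2) * 2 * (L / 2 ^ Suc m) \<le> real k * (L / 2 ^ Suc m)"
    "(real k + 1) * (L / 2 ^ Suc m) \<le> (real (k div 2) + 1) * 2 * (L / 2 ^ Suc m)"
    using assms by (intro mult_right_mono; simp)+
  have eq: "c * 2 * (L / 2 ^ Suc m) = c * L / 2 ^ m" for c :: real by simp
  show ?thesis using le[unfolded eq] unfolding cell_def by (intro ivl_subset[THEN iffD2] disjI2) simp
qed

lemma cell_subset:
  assumes "L > 0" "k < 2 ^ m"
  shows "cell A L m k \<subseteq> {A..<A + L}"
  using assms(2)
proof (induction m arbitrary: k)
  case (Suc m)
  then have "cell A L m (k div 2) \<subseteq> {A..<A + L}" by (intro Suc.IH) auto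
  then show ?case using cell_parent[OF assms(1)] by blast
qed (simp add: cell_0)

lemma cell_nested:
  assumes L: "L > 0" and "m' \<le> m" "x \<in> cell A L m k" "x \<in> cell A L m' k'"
  shows "cell A L m k \<subseteq> cell A L m' k'"
  using assms(2,3)
proof (induction m arbitrary: k rule: dec_induct)
  case base
  then show ?case using assms(4) by (simp add: cell_iff[OF L])
next
  case (step m)
  then have "x \<in> cell A L m (k div 2)" using cell_parent[OF L] by blast
  then show ?case using step.IH cell_parent[OF L] by blast
qed

lemma cell_cover:
  assumes L: "L > 0" and x: "x \<in> {A..<A + L}"
  obtains k where "k < 2 ^ m" "x \<in> cell A L m k"
proof -
  have "(x - A) / L * 2 ^ m < 1 * 2 ^ m"
    using assms by (intro mult_strict_right_mono) (auto simp: field_simps)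
  then have "(x - A) * 2 ^ m / L < 2 ^ m" by simp
  moreover have "(x - A) * 2 ^ m / L \<ge> 0" using assms by simp
  ultimately have "nat \<lfloor>(x - A) * 2 ^ m / L\<rfloor> < 2 ^ m" by (simp add: nat_less_iff floor_less_iff)
  then show ?thesis using that cell_iff[OF L] x by auto
qed

lemma cell_in_open:
  assumes L: "L > 0" and U: "open U" "x \<in> U"
  obtains m where "\<And>k m'. m \<le> m' \<Longrightarrow> x \<in> cell A L m' k \<Longrightarrow> cell A L m' k \<subseteq> U"
proof -
  obtain e where e: "e > 0" "ball x e \<subseteq> U" using U by (auto simp: open_contains_ball)
  obtain m where m: "L / e < 2 ^ m" using real_arch_pow[of 2 "L / e"] by auto
  show ?thesis
  proof (rule that)
    fix k m' assume m': "m \<le> m'" and x: "x \<in> cell A L m' k"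
    have "e * 2 ^ m \<le> e * 2 ^ m'" using m' e by (simp add: power_increasing)
    moreover have "L < e * 2 ^ m" using m e by (simp add: field_simps)
    ultimately have "L < e * 2 ^ m'" by linarith
    then have "L / 2 ^ m' < e" by (simp add: field_simps)
    then have "cell A L m' k \<subseteq> ball x e"
      using x by (auto simp: cell_def dist_real_def abs_if algebra_simps add_divide_distrib)
    then show "cell A L m' k \<subseteq> U" using e by blast
  qed
qed

section \<open>A Calderon-Zygmund decomposition\<close>

text \<open>The maximal dyadic cells on which an open set of small measure has density above \<open>\<theta>\<close>. As the
  set is open, they cover it without an exceptional null set. A maximal cell has density at most
  \<open>2 * \<theta>\<close> because its parent has density at most \<open>\<theta>\<close>.\<close>

lemma maximal_dense_cells:
  assumes L: "L > 0" and U: "open U" and lam: "0 < \<theta>" "\<theta> < 1"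
    and small: "measure lborel (U \<inter> {A..<A + L}) \<le> \<theta> * L"
  obtains K :: "nat \<Rightarrow> real set" and S :: "nat set"
  where "\<And>j. j \<in> S \<Longrightarrow> \<exists>m k. k < 2 ^ m \<and> K j = cell A L m k"
    and "disjoint_family_on K S"
    and "U \<inter> {A..<A + L} \<subseteq> (\<Union>j\<in>S. K j)"
    and "\<And>j. j \<in> S \<Longrightarrow> \<theta> * measure lborel (K j) < measure lborel (U \<inter> K j)"
    and "\<And>j. j \<in> S \<Longrightarrow> measure lborel (U \<inter> K j) \<le> 2 * \<theta> * measure lborel (K j)"
proof -
  define dense where "dense m k \<longleftrightarrow>
    k < 2 ^ m \<and> \<theta> * measure lborel (cell A L m k) < measure lborel (U \<inter> cell A L m k)" for m k :: nat
  \<comment> \<open>The maximal dense cells.\<close>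
  define sel where "sel m k \<longleftrightarrow>
    dense m k \<and> (\<forall>m'<m. \<forall>k'. cell A L m k \<subseteq> cell A L m' k' \<longrightarrow> \<not> dense m' k')" for m k :: nat
  define K where "K j = (case prod_decode j of (m, k) \<Rightarrow> cell A L m k)" for j
  define S where "S = {j. case prod_decode j of (m, k) \<Rightarrow> sel m k}"
  have disj_less: "cell A L m k \<inter> cell A L m' k' = {}" if "sel m k" "sel m' k'" "m' < m" for m k m' k'
  proof (rule ccontr)
    assume "\<not> ?thesis"
    then have "cell A L m k \<subseteq> cell A L m' k'" using cell_nested[OF L, of m' m] that by fastforce
    then show False using that by (auto simp: sel_def)
  qed
  have disj: "cell A L m k \<inter> cell A L m' k' = {}"
    if "sel m k" "sel m' k'" "(m, k) \<noteq> (m', k')" for m k m' k'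
  proof (cases m m' rule: linorder_cases)
    case equal
    then show ?thesis using that cell_iff[OF L] by auto
  qed (use disj_less that in blast)+
  show ?thesis
  proof (rule that)
    show "\<exists>m k. k < 2 ^ m \<and> K j = cell A L m k" if "j \<in> S" for j
      using that by (auto simp: S_def K_def sel_def dense_def split: prod.splits)
    show "disjoint_family_on K S"
      unfolding disjoint_family_on_def
    proof (intro ballI impI)
      fix i j assume "i \<in> S" "j \<in> S" "i \<noteq> j"
      moreover have "prod_decode i \<noteq> prod_decode j"
        using \<open>i \<noteq> j\<close> by (metis prod_decode_inverse)
      ultimately show "K i \<inter> K j = {}"
        using disj[of "fst (prod_decode i)" "snd (prod_decode i)"
            "fst (prod_decode j)" "snd (prod_decode j)"]
        by (simp add: S_def K_def case_prod_beta)
    qed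
    show "U \<inter> {A..<A + L} \<subseteq> (\<Union>j\<in>S. K j)"
    proof
      fix x assume x: "x \<in> U \<inter> {A..<A + L}"
      obtain m0 where m0: "\<And>k m'. m0 \<le> m' \<Longrightarrow> x \<in> cell A L m' k \<Longrightarrow> cell A L m' k \<subseteq> U"
        using cell_in_open[OF L U, of x A] x by blast
      obtain k0 where k0: "k0 < 2 ^ m0" "x \<in> cell A L m0 k0" using cell_cover[OF L, of x A m0] x by blast
      \<comment> \<open>Among the dense cells containing the point, that of least level is maximal.\<close>
      define P where "P m \<longleftrightarrow> (\<exists>k. dense m k \<and> x \<in> cell A L m k)" for m
      have "U \<inter> cell A L m0 k0 = cell A L m0 k0" using m0[OF _ k0(2)] by auto
      then have "dense m0 k0" using k0 L lam by (simp add: dense_def measure_cell field_simps)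
      then have "P m0" using k0 by (auto simp: P_def)
      then have "P (LEAST m. P m)" by (rule LeastI)
      then obtain m k where m: "m = (LEAST m. P m)" "dense m k" "x \<in> cell A L m k"
        by (auto simp: P_def)
      have least: "\<not> P m'" if "m' < m" for m' using that m(1) not_less_Least by blast
      have "\<not> dense m' k'" if "m' < m" "cell A L m k \<subseteq> cell A L m' k'" for m' k'
        using that m least[of m'] by (auto simp: P_def)
      then have "sel m k" using m by (auto simp: sel_def)
      then have "prod_encode (m, k) \<in> S" "x \<in> K (prod_encode (m, k))"
        using m by (auto simp: S_def K_def)
      then show "x \<in> (\<Union>j\<in>S. K j)" by blast
    qed
    show "\<theta> * measure lborel (K j) < measure lborel (U \<inter> K j)" if "j \<in> S" for j
      using that by (auto simp: S_def K_def sel_def dense_def split: prod.splits)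
    show "measure lborel (U \<inter> K j) \<le> 2 * \<theta> * measure lborel (K j)" if "j \<in> S" for j
    proof -
      obtain m k where mk: "prod_decode j = (m, k)" by (cases "prod_decode j")
      then have s: "sel m k" "K j = cell A L m k" using that by (auto simp: S_def K_def)
      then have d: "dense m k" by (simp add: sel_def)
      show ?thesis
      proof (cases m)
        \<comment> \<open>The whole interval is not dense, by the smallness assumption.\<close>
        case 0
        then have "k = 0" using d by (simp add: dense_def)
        then show ?thesis using d 0 small L by (simp add: dense_def cell_0)
      next
        case (Suc m')
        have sub: "cell A L m k \<subseteq> cell A L m' (k div 2)" using cell_parent[OF L] Suc by simp
        then have "\<not> dense m' (k div 2)" using s(1) Suc by (auto simp: sel_def)
        moreover have "k div 2 < 2 ^ m'" using d Suc by (auto simp: dense_def)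
        ultimately have "measure lborel (U \<inter> cell A L m' (k div 2)) \<le> \<theta> * (L / 2 ^ m')"
          using L by (simp add: dense_def measure_cell)
        moreover have "measure lborel (U \<inter> cell A L m k) \<le> measure lborel (U \<inter> cell A L m' (k div 2))"
        proof (rule measure_mono_fmeasurable)
          show "U \<inter> cell A L m k \<in> sets lborel" using U cell_interval(3) by auto
          show "U \<inter> cell A L m' (k div 2) \<in> fmeasurable lborel"
            using U cell_interval(3)
              emeasure_bounded_finite[OF bounded_subset[OF cell_interval(2) Int_lower2[of U "cell A L m' (k div 2)"]]]
            by (intro fmeasurableI) auto
        qed (use sub in auto)
        ultimately show ?thesis using s(2) L Suc by (simp add: measure_cell)
      qed
    qed
  qed
qed

text \<open>With the maximal cells \<open>K\<close> of density above \<open>\<theta>\<close>, subtracting from \<open>u\<close> its mean on each \<open>K\<close>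
  gives a series of multiples of atoms with coefficients \<open>2 * |K|\<close>, of sum at most \<open>2 * \<delta> / \<theta>\<close>.
  What remains is bounded by \<open>3 * \<theta>\<close> and has mean zero.\<close>

lemma H1_norm_small_support:
  fixes u :: "real \<Rightarrow> real"
  assumes L: "L > 0" and U: "open U" and lam: "0 < \<theta>" "\<theta> < 1"
    and small: "measure lborel (U \<inter> {A..<A + L}) \<le> \<delta>" "\<delta> \<le> \<theta> * L"
    and u: "u \<in> borel_measurable borel" "\<And>x. \<bar>u x\<bar> \<le> 1" "\<And>x. x \<notin> U \<inter> {A..<A + L} \<Longrightarrow> u x = 0"
  defines "v \<equiv> (\<lambda>x. u x - (LBINT x. u x) / L * indicator {A..<A + L} x)"
  shows "v \<in> H1" "H1_norm v \<le> 2 * \<delta> / \<theta> + 3 * \<theta> * L"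
proof -
  define I where "I = {A..<A + L}"
  have I: "is_interval I" "bounded I" "measure lborel I = L" "I \<in> sets borel"
    using L by (auto simp: I_def is_interval_co)
  have UI: "U \<inter> I \<in> sets borel" "bounded (U \<inter> I)" using U I by (auto intro: bounded_subset)
  have u3: "u x = 0" if "x \<notin> U \<inter> I" for x using u(3) that by (simp add: I_def)
  have ui: "integrable lborel u"
    using integrable_bounded_support[OF u(1) UI u3 u(2)] by blast
  have fm: "U \<inter> X \<in> fmeasurable lborel" if "X \<in> sets borel" "bounded X" for X
    using U that emeasure_bounded_finite[of "U \<inter> X"] by (intro fmeasurableI) (auto intro: bounded_subset)
  have "measure lborel (U \<inter> {A..<A + L}) \<le> \<theta> * L" using small by linarith
  then obtain K :: "nat \<Rightarrow> real set" and S :: "nat set" where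
    K: "\<And>j. j \<in> S \<Longrightarrow> \<exists>m k. k < 2 ^ m \<and> K j = cell A L m k"
    and disj: "disjoint_family_on K S"
    and cover: "U \<inter> {A..<A + L} \<subseteq> (\<Union>j\<in>S. K j)"
    and dlow: "\<And>j. j \<in> S \<Longrightarrow> \<theta> * measure lborel (K j) < measure lborel (U \<inter> K j)"
    and dup: "\<And>j. j \<in> S \<Longrightarrow> measure lborel (U \<inter> K j) \<le> 2 * \<theta> * measure lborel (K j)"
    using maximal_dense_cells[OF L U lam] by metis
  have Kint: "is_interval (K j)" "bounded (K j)" "K j \<in> sets borel" "measure lborel (K j) > 0" "K j \<subseteq> I"
    if "j \<in> S" for j
  proof -
    obtain m k where "k < 2 ^ m" "K j = cell A L m k" using K[OF \<open>j \<in> S\<close>] by blast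
    then show "is_interval (K j)" "bounded (K j)" "K j \<in> sets borel" "measure lborel (K j) > 0" "K j \<subseteq> I"
      using cell_interval[of A L m k] L cell_subset[OF L, of k m A] by (simp_all add: measure_cell I_def)
  qed
  define c where "c j = (LBINT x:K j. u x) / measure lborel (K j)" for j
  have uK: "set_integrable lborel (K j) u" if "j \<in> S" for j
    unfolding set_integrable_def using Kint[OF that] ui by (intro integrable_mult_indicator) auto
  have cU: "\<bar>c j\<bar> \<le> measure lborel (U \<inter> K j) / measure lborel (K j)" if "j \<in> S" for j
  proof -
    have "\<bar>LBINT x:K j. u x\<bar> \<le> (LBINT x. \<bar>indicator (K j) x * u x\<bar>)"
      unfolding set_lebesgue_integral_def real_scaleR_def by (rule integral_abs_bound)
    also have "\<dots> \<le> 1 * measure lborel (U \<inter> K j)"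
    proof (rule integral_abs_bounded_support)
      show "U \<inter> K j \<in> sets borel" "bounded (U \<inter> K j)"
        using U Kint[OF that] by (auto intro: bounded_subset)
      show "(\<lambda>x. indicator (K j) x * u x) \<in> borel_measurable borel"
        using u(1) Kint[OF that] by measurable
      show "\<bar>indicator (K j) x * u x\<bar> \<le> 1" for x using u(2)[of x] by (auto simp: indicator_def)
      show "indicator (K j) x * u x = 0" if "x \<notin> U \<inter> K j" for x
        using that u3[of x] by (auto simp: indicator_def)
    qed
    finally show ?thesis unfolding c_def using Kint[OF that] by (simp add: divide_right_mono)
  qed
  have c2: "\<bar>c j\<bar> \<le> 2 * \<theta>" if "j \<in> S" for j
  proof -
    have "measure lborel (U \<inter> K j) / measure lborel (K j) \<le> 2 * \<theta>"
      using dup[OF that] Kint[OF that] by (simp add: field_simps)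
    then show ?thesis using cU[OF that] by linarith
  qed
  have c1: "\<bar>c j\<bar> \<le> 1" if "j \<in> S" for j
  proof -
    have "measure lborel (U \<inter> K j) \<le> measure lborel (K j)"
      using Kint[OF that] emeasure_bounded_finite[of "K j"] U
      by (intro measure_mono_fmeasurable fmeasurableI) auto
    then have "measure lborel (U \<inter> K j) / measure lborel (K j) \<le> 1"
      using Kint[OF that] by (simp add: field_simps)
    then show ?thesis using cU[OF that] by linarith
  qed
  \<comment> \<open>Indices outside \<open>S\<close> contribute the zero atom with coefficient zero.\<close>
  define w where "w j x = indicator (K j) x * (u x - c j)" for j x
  define l where "l j = (if j \<in> S then 2 * measure lborel (K j) else 0)" for j
  define a where "a j = (\<lambda>x. if j \<in> S then w j x / (2 * measure lborel (K j)) else 0)" for j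
  have w: "w j \<in> borel_measurable borel" "\<And>x. x \<notin> K j \<Longrightarrow> w j x = 0" "\<And>x. \<bar>w j x\<bar> \<le> 2"
    "(LBINT x. w j x) = 0" if j: "j \<in> S" for j
  proof -
    show "w j \<in> borel_measurable borel" unfolding w_def using u(1) Kint[OF j] by measurable
    show "w j x = 0" if "x \<notin> K j" for x using that by (simp add: w_def)
    show "\<bar>w j x\<bar> \<le> 2" for x
      using u(2)[of x] c1[OF j] abs_triangle_ineq4[of "u x" "c j"] by (simp add: w_def indicator_def)
    have ci: "set_integrable lborel (K j) (\<lambda>x. c j)"
      unfolding set_integrable_def using Kint[OF j] emeasure_bounded_finite[of "K j"]
      by (auto intro!: integrable_mult_left integrable_real_indicator)
    have "(LBINT x. w j x) = (LBINT x:K j. u x - c j)"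
      by (simp add: w_def set_lebesgue_integral_def)
    also have "\<dots> = (LBINT x:K j. u x) - (LBINT x:K j. c j)"
      using uK[OF j] ci by (rule set_integral_diff)
    also have "(LBINT x:K j. c j) = measure lborel (K j) * c j"
      by (simp add: set_lebesgue_integral_def)
    finally show "(LBINT x. w j x) = 0" using Kint[OF j] by (simp add: c_def)
  qed
  have at: "is_atom (a j)" for j
  proof (cases "j \<in> S")
    case True
    then show ?thesis
      using atom_on_normalized(1)[OF Kint(1,2,4)[OF True] w[OF True]] by (auto simp: a_def is_atom_def)
  qed (simp add: a_def zero_is_atom)
  have la: "l j * a j x = (if j \<in> S then w j x else 0)" for j x
    using Kint[of j] by (auto simp: l_def a_def)
  have lsum: "(\<Sum>j<n. \<bar>l j\<bar>) \<le> 2 * \<delta> / \<theta>" for n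
  proof -
    have "(\<Sum>j<n. \<bar>l j\<bar>) = (\<Sum>j\<in>{..<n} \<inter> S. 2 * measure lborel (K j))"
      by (subst sum.inter_restrict) (auto simp: l_def intro!: sum.cong)
    also have "\<dots> \<le> (\<Sum>j\<in>{..<n} \<inter> S. 2 / \<theta> * measure lborel (U \<inter> K j))"
      using dlow lam by (intro sum_mono) (auto simp: field_simps less_imp_le)
    also have "\<dots> = 2 / \<theta> * (\<Sum>j\<in>{..<n} \<inter> S. measure lborel (U \<inter> K j))"
      by (simp add: sum_distrib_left)
    also have "(\<Sum>j\<in>{..<n} \<inter> S. measure lborel (U \<inter> K j)) = measure lborel (\<Union>j\<in>{..<n} \<inter> S. U \<inter> K j)"
    proof (rule measure_UNION'[symmetric])
      show "pairwise (\<lambda>i j. disjnt (U \<inter> K i) (U \<inter> K j)) ({..<n} \<inter> S)"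
        using disj by (auto simp: pairwise_def disjnt_def disjoint_family_on_def)
    qed (use fm Kint in auto)
    also have "2 / \<theta> * measure lborel (\<Union>j\<in>{..<n} \<inter> S. U \<inter> K j) \<le> 2 / \<theta> * \<delta>"
    proof (rule mult_left_mono)
      have "measure lborel (\<Union>j\<in>{..<n} \<inter> S. U \<inter> K j) \<le> measure lborel (U \<inter> I)"
      proof (rule measure_mono_fmeasurable)
        show "(\<Union>j\<in>{..<n} \<inter> S. U \<inter> K j) \<subseteq> U \<inter> I" using Kint(5) by blast
      qed (use Kint(3) U fm[OF I(4,2)] in auto)
      also have "\<dots> \<le> \<delta>" using small by (simp add: I_def)
      finally show "measure lborel (\<Union>j\<in>{..<n} \<inter> S. U \<inter> K j) \<le> \<delta>" .
    qed (use lam in simp)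
    finally show ?thesis by simp
  qed
  have ls: "summable (\<lambda>j. \<bar>l j\<bar>)" by (rule summableI_nonneg_bounded[OF _ lsum]) simp
  define b where "b = (\<lambda>x. \<Sum>j. l j * a j x)"
  have only: "l i * a i x = 0" if "j \<in> S" "x \<in> K j" "i \<noteq> j" for i j x
    using that disj by (auto simp: la w_def indicator_def disjoint_family_on_def)
  have none: "l i * a i x = 0" if "x \<notin> (\<Union>j\<in>S. K j)" for i x
    using that by (auto simp: la w_def indicator_def)
  have pt: "summable (\<lambda>j. \<bar>l j * a j x\<bar>)" for x
  proof (cases "x \<in> (\<Union>j\<in>S. K j)")
    case True
    then obtain j where "j \<in> S" "x \<in> K j" by blast
    then show ?thesis using only by (intro summable_finite[of "{j}"]) auto
  next
    case False
    then show ?thesis using none[OF False] by (intro summable_finite[of "{}"]) auto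
  qed
  have b_in: "b x = u x - c j" if "j \<in> S" "x \<in> K j" for j x
  proof -
    have "b x = (\<Sum>i\<in>{j}. l i * a i x)"
      unfolding b_def using only[OF that] by (intro suminf_finite) auto
    then show ?thesis using that by (simp add: la w_def)
  qed
  have b_out: "b x = 0" if "x \<notin> (\<Union>j\<in>S. K j)" for x
    by (simp only: b_def none[OF that] suminf_zero)
  have bH: "b \<in> H1" "H1_norm b \<le> 2 * \<delta> / \<theta>"
  proof -
    show "b \<in> H1" unfolding b_def by (rule H1_atomic_series[OF at ls pt])
    have "H1_norm b \<le> (\<Sum>j. \<bar>l j\<bar>)" unfolding b_def by (rule H1_atomic_series[OF at ls pt])
    also have "\<dots> \<le> 2 * \<delta> / \<theta>" using lsum ls by (intro suminf_le_const) auto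
    finally show "H1_norm b \<le> 2 * \<delta> / \<theta>" .
  qed
  define \<mu> where "\<mu> = (LBINT x. u x) / L"
  have v: "v x = u x - \<mu> * indicator I x" for x by (simp add: v_def \<mu>_def I_def)
  have mu: "\<bar>\<mu>\<bar> \<le> \<theta>"
  proof -
    have "\<bar>LBINT x. u x\<bar> \<le> (LBINT x. \<bar>u x\<bar>)" by (rule integral_abs_bound)
    also have "\<dots> \<le> 1 * measure lborel (U \<inter> I)"
      by (rule integral_abs_bounded_support[OF u(1) UI u3 u(2)])
    also have "\<dots> \<le> \<theta> * L" using small by (simp add: I_def)
    finally show ?thesis using L by (simp add: \<mu>_def abs_divide field_simps)
  qed
  have g: "v - b \<in> H1" "H1_norm (v - b) \<le> (3 * \<theta>) * measure lborel I"
  proof -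
    have vi: "integrable lborel v" "(LBINT x. v x) = 0"
    proof -
      have ii: "integrable lborel (\<lambda>x. \<mu> * indicator I x)"
        using I emeasure_bounded_finite[OF I(2)]
        by (intro integrable_mult_right integrable_real_indicator) auto
      show "integrable lborel v" unfolding v using ui ii by (rule Bochner_Integration.integrable_diff)
      have "(LBINT x. v x) = (LBINT x. u x) - (LBINT x. \<mu> * indicator I x)"
        unfolding v using ui ii by (rule Bochner_Integration.integral_diff)
      then show "(LBINT x. v x) = 0" using L I(3) by (simp add: \<mu>_def)
    qed
    have meas: "v - b \<in> borel_measurable borel"
      using borel_measurable_integrable[OF vi(1)] H1_measurable[OF bH(1)]
      by (simp add: fun_diff_def)
    have out: "(v - b) x = 0" if "x \<notin> I" for x
    proof -
      have "x \<notin> (\<Union>j\<in>S. K j)" using Kint(5) that by blast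
      then show ?thesis using b_out u3[of x] that by (simp add: v)
    qed
    have bd: "\<bar>(v - b) x\<bar> \<le> 3 * \<theta>" for x
    proof (cases "x \<in> (\<Union>j\<in>S. K j)")
      case True
      then obtain j where j: "j \<in> S" "x \<in> K j" by blast
      then have "x \<in> I" using Kint(5) by blast
      then have "(v - b) x = c j - \<mu>" using b_in[OF j] by (simp add: v)
      then show ?thesis using c2[OF j(1)] mu by linarith
    next
      case False
      then have "x \<notin> U \<inter> {A..<A + L}" using cover by blast
      then have "u x = 0" by (rule u(3))
      then have "(v - b) x = - \<mu> * indicator I x" using b_out[OF False] by (simp add: v)
      then show ?thesis using mu lam by (auto simp: indicator_def)
    qed
    have zero: "(LBINT x. (v - b) x) = 0"
      using vi H1_integrable[OF bH(1)] H1_integral_zero[OF bH(1)] by simp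
    have pos: "measure lborel I > 0" using I L by simp
    show "v - b \<in> H1" "H1_norm (v - b) \<le> (3 * \<theta>) * measure lborel I"
      using H1_bounded_support[OF I(1,2) pos meas out bd zero] by blast+
  qed
  have "b + (v - b) = v" by simp
  then show "v \<in> H1" "H1_norm v \<le> 2 * \<delta> / \<theta> + 3 * \<theta> * L"
    using H1_add[OF bH(1) g(1)] bH(2) g(2) I(3) by auto
qed

section \<open>Approximation by Haar functions\<close>

lemma cell_disjoint:
  assumes "L > 0"
  shows "disjoint_family_on (cell A L m) J"
  using cell_iff[OF assms] by (auto simp: disjoint_family_on_def)

lemma cell_halves:
  assumes "L > 0"
  shows "cell A L (Suc m) (2 * k) = {A + real k * L / 2 ^ m ..< A + (real k + 1 / 2) * L / 2 ^ m}"
    and "cell A L (Suc m) (2 * k + 1) = {A + (real k + 1 / 2) * L / 2 ^ m ..< A + (real k + 1) * L / 2 ^ m}"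
    and "indicator (cell A L m k) x =
      (indicator (cell A L (Suc m) (2 * k)) x + indicator (cell A L (Suc m) (2 * k + 1)) x :: real)"
proof -
  have le: "real k * L / 2 ^ m \<le> (real k + 1 / 2) * L / 2 ^ m"
    "(real k + 1 / 2) * L / 2 ^ m \<le> (real k + 1) * L / 2 ^ m"
    using assms by (intro divide_right_mono mult_right_mono; simp)+
  have "real (2 * k) * L / 2 ^ Suc m = real k * L / 2 ^ m" by simp
  moreover have "(real (2 * k) + 1) * L / 2 ^ Suc m = (real k + 1 / 2) * L / 2 ^ m"
    by (simp add: field_simps)
  moreover have "real (2 * k + 1) * L / 2 ^ Suc m = (real k + 1 / 2) * L / 2 ^ m"
    by (simp add: field_simps)
  moreover have "(real (2 * k + 1) + 1) * L / 2 ^ Suc m = (real k + 1) * L / 2 ^ m"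
    by (simp add: field_simps)
  ultimately show *: "cell A L (Suc m) (2 * k) = {A + real k * L / 2 ^ m ..< A + (real k + 1 / 2) * L / 2 ^ m}"
    "cell A L (Suc m) (2 * k + 1) = {A + (real k + 1 / 2) * L / 2 ^ m ..< A + (real k + 1) * L / 2 ^ m}"
    unfolding cell_def by (simp_all only:)
  have "cell A L m k = cell A L (Suc m) (2 * k) \<union> cell A L (Suc m) (2 * k + 1)"
    unfolding * unfolding cell_def by (rule ivl_disj_un_two(3)[symmetric]) (use le in simp_all)
  moreover have "cell A L (Suc m) (2 * k) \<inter> cell A L (Suc m) (2 * k + 1) = {}"
    unfolding * by auto
  ultimately show "indicator (cell A L m k) x =
      (indicator (cell A L (Suc m) (2 * k)) x + indicator (cell A L (Suc m) (2 * k + 1)) x :: real)"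
    by (simp add: indicator_add)
qed

lemma haar_cell:
  assumes "L > 0"
  shows "haar (cell A L m k) x =
    2 ^ m / L * (indicator (cell A L (Suc m) (2 * k)) x - indicator (cell A L (Suc m) (2 * k + 1)) x)"
proof -
  have lt: "A + real k * L / 2 ^ m < A + (real k + 1) * L / 2 ^ m"
    using assms by (simp add: divide_strict_right_mono)
  have mid: "(A + real k * L / 2 ^ m + (A + (real k + 1) * L / 2 ^ m)) / 2 = A + (real k + 1 / 2) * L / 2 ^ m"
    by (simp add: field_simps)
  have halves: "left_half {x..<y} = {x..<(x + y) / 2}" "right_half {x..<y} = {(x + y) / 2..<y}"
    if "x < y" for x y :: real
    using that by (simp_all add: left_half_def right_half_def)
  have "left_half (cell A L m k) = cell A L (Suc m) (2 * k)"
    "right_half (cell A L m k) = cell A L (Suc m) (2 * k + 1)"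
    unfolding cell_halves(1,2)[OF assms] unfolding cell_def halves(1)[OF lt] halves(2)[OF lt] mid
    by (rule refl)+
  then show ?thesis
    using assms by (simp add: haar_def interval_length_def measure_cell right_diff_distrib)
qed

lemma cell_dyadic:
  fixes p n :: int
  assumes "A = of_int p * 2 powi n" "L = 2 powi n"
  shows "cell A L m k \<in> dyadic_intervals"
proof -
  have L: "2 powi n / 2 ^ m = (2::real) powi (n - int m)"
    by (simp add: power_int_diff)
  have A: "of_int p * 2 powi n = of_int p * 2 ^ m * (2::real) powi (n - int m)"
    by (simp add: power_int_diff)
  have "cell A L m k = {of_int (p * 2 ^ m + int k) * 2 powi (n - int m)
      ..< (of_int (p * 2 ^ m + int k) + 1) * 2 powi (n - int m)}"
    unfolding cell_def assms times_divide_eq_right[symmetric] L A by (simp add: algebra_simps)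
  then show ?thesis unfolding dyadic_intervals_def by blast
qed

text \<open>The centered indicator of a dyadic cell is a finite combination of Haar functions: the
  indicator of a half of a cell is half of the indicator of the cell, up to a multiple of the Haar
  function of the cell.\<close>

lemma centered_cell_in_span:
  fixes p n :: int
  assumes D: "A = of_int p * 2 powi n" "L = 2 powi n" and "k < 2 ^ m"
  shows "(\<lambda>x. indicator (cell A L m k) x - 1 / 2 ^ m * indicator {A..<A + L} x) \<in> span haar_system"
  using assms(3)
proof (induction m arbitrary: k)
  case 0
  then have "(\<lambda>x. indicator (cell A L 0 k) x - 1 / 2 ^ 0 * indicator {A..<A + L} x) = (0 :: real \<Rightarrow> real)"
    by (auto simp: cell_0 fun_eq_iff)
  then show ?case using span_zero by metis
next
  case (Suc m)
  have L: "L > 0" using D by simp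
  define j where "j = k div 2"
  define s :: real where "s = (if even k then 1 else - 1)"
  define F where "F = (\<lambda>x. indicator (cell A L m j) x - 1 / 2 ^ m * indicator {A..<A + L} x :: real)"
  have "F \<in> span haar_system" unfolding F_def by (rule Suc.IH) (use Suc.prems in \<open>simp add: j_def\<close>)
  moreover have "haar (cell A L m j) \<in> span haar_system"
    using cell_dyadic[OF D] by (auto intro!: span_base simp: haar_system_def)
  ultimately have "(1 / 2) *\<^sub>R F + (s * L / 2 ^ Suc m) *\<^sub>R haar (cell A L m j) \<in> span haar_system"
    by (intro span_add span_scale)
  moreover have "(1 / 2) *\<^sub>R F + (s * L / 2 ^ Suc m) *\<^sub>R haar (cell A L m j) =
    (\<lambda>x. indicator (cell A L (Suc m) k) x - 1 / 2 ^ Suc m * indicator {A..<A + L} x)"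
  proof
    fix x
    define P Q :: real
      where "P = indicator (cell A L (Suc m) (2 * j)) x" and "Q = indicator (cell A L (Suc m) (2 * j + 1)) x"
    have parent: "indicator (cell A L m j) x = P + Q"
      unfolding P_def Q_def by (rule cell_halves(3)[OF L])
    have child: "indicator (cell A L (Suc m) k) x = (P + Q) / 2 + s * (P - Q) / 2"
    proof (cases "even k")
      case True
      then have "k = 2 * j" by (simp add: j_def)
      then show ?thesis using True by (simp add: P_def s_def field_simps)
    next
      case False
      then have "k = 2 * j + 1" by (simp add: j_def)
      then show ?thesis using False by (simp add: Q_def s_def field_simps)
    qed
    have "s * L / 2 ^ Suc m * (2 ^ m / L * (P - Q)) = s * (P - Q) / 2"
      using L by simp
    then show "((1 / 2) *\<^sub>R F + (s * L / 2 ^ Suc m) *\<^sub>R haar (cell A L m j)) x =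
      indicator (cell A L (Suc m) k) x - 1 / 2 ^ Suc m * indicator {A..<A + L} x"
      unfolding plus_fun_apply scaleR_fun_apply haar_cell[OF L] P_def[symmetric] Q_def[symmetric]
        F_def parent child real_scaleR_def
      by (simp add: right_diff_distrib)
  qed
  ultimately show ?case by simp
qed

text \<open>A Borel set is close in measure to an open set. The cells of level \<open>m\<close> inside the open set fill
  it up, within the given interval, as \<open>m\<close> grows.\<close>

lemma dyadic_approximation:
  assumes L: "L > 0" and E: "E \<in> sets borel" "E \<subseteq> {A..<A + L}" and e: "e > 0"
  obtains m J where "J \<subseteq> {..<2 ^ m}" "measure lborel (sym_diff E (\<Union>k\<in>J. cell A L m k)) < e"
proof -
  define I where "I = {A..<A + L}"
  have I: "I \<in> sets borel" "bounded I" by (auto simp: I_def)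
  have fm: "X \<in> fmeasurable lborel" if "X \<in> sets borel" "X \<subseteq> I" for X
    using that emeasure_bounded_finite[OF bounded_subset[OF I(2) that(2)]] by (intro fmeasurableI) auto
  obtain U where U: "open U" "E \<subseteq> U" "emeasure lborel (U - E) < e / 2"
    using outer_regular_lborel[OF E(1), of "e / 2"] e by auto
  have UE: "measure lborel (I \<inter> U - E) < e / 2"
  proof -
    have "emeasure lborel (I \<inter> U - E) \<le> emeasure lborel (U - E)"
      using U E by (intro emeasure_mono) auto
    then have "ennreal (measure lborel (I \<inter> U - E)) < ennreal (e / 2)"
      using U(3) fm[of "I \<inter> U - E"] U(1) E I
      by (subst emeasure_eq_measure2[symmetric]) (auto intro: le_less_trans)
    then show ?thesis using e by (simp add: ennreal_less_iff)
  qed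
  define J where "J m = {k. k < 2 ^ m \<and> cell A L m k \<subseteq> U}" for m
  define V where "V m = (\<Union>k\<in>J m. cell A L m k)" for m
  have Jfin: "finite (J m)" for m by (simp add: J_def)
  have Vb: "V m \<in> sets borel" for m unfolding V_def using Jfin cell_interval(3) by auto
  have VI: "V m \<subseteq> I" for m unfolding V_def J_def I_def using cell_subset[OF L] by blast
  have VU: "V m \<subseteq> U" for m unfolding V_def J_def by blast
  have inc: "incseq V"
  proof (rule incseq_SucI, rule subsetI)
    fix m x assume "x \<in> V m"
    then obtain k where k: "k < 2 ^ m" "cell A L m k \<subseteq> U" "x \<in> cell A L m k"
      by (auto simp: V_def J_def)
    have "x \<in> {A..<A + L}" using cell_subset[OF L k(1)] k(3) by blast
    then obtain k' where k': "k' < 2 ^ Suc m" "x \<in> cell A L (Suc m) k'"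
      using cell_cover[OF L] by blast
    have "cell A L (Suc m) k' \<subseteq> cell A L m k" using cell_nested[OF L _ k'(2) k(3)] by simp
    then show "x \<in> V (Suc m)" using k k' by (auto simp: V_def J_def)
  qed
  have Un: "(\<Union>m. V m) = I \<inter> U"
  proof
    show "(\<Union>m. V m) \<subseteq> I \<inter> U" using VI VU by blast
    show "I \<inter> U \<subseteq> (\<Union>m. V m)"
    proof
      fix x assume x: "x \<in> I \<inter> U"
      obtain m where m: "\<And>k m'. m \<le> m' \<Longrightarrow> x \<in> cell A L m' k \<Longrightarrow> cell A L m' k \<subseteq> U"
        using cell_in_open[OF L U(1), of x A] x by blast
      obtain k where "k < 2 ^ m" "x \<in> cell A L m k" using cell_cover[OF L, of x A m] x by (auto simp: I_def)
      moreover from this have "cell A L m k \<subseteq> U" by (intro m) auto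
      ultimately show "x \<in> (\<Union>m. V m)" by (auto simp: V_def J_def)
    qed
  qed
  have "I \<inter> U \<in> fmeasurable lborel" using I U by (intro fm) auto
  then have fin: "emeasure lborel (\<Union>m. V m) \<noteq> \<infinity>" unfolding Un by (auto simp: fmeasurable_def)
  have "range V \<subseteq> sets lborel" using Vb by auto
  then have "(\<lambda>m. measure lborel (V m)) \<longlonglongrightarrow> measure lborel (I \<inter> U)"
    using Lim_measure_incseq[OF _ inc fin] unfolding Un by blast
  then obtain m where m: "\<bar>measure lborel (V m) - measure lborel (I \<inter> U)\<bar> < e / 2"
    using e by (auto simp: LIMSEQ_iff dest!: spec[of _ "e / 2"])
  have "measure lborel (I \<inter> U - V m) = measure lborel (I \<inter> U) - measure lborel (V m)"
    using VI VU Vb U I fm[of "I \<inter> U"] by (intro measurable_measure_Diff) auto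
  then have UV: "measure lborel (I \<inter> U - V m) < e / 2" using m by linarith
  have "measure lborel (sym_diff E (V m)) \<le> measure lborel ((I \<inter> U - E) \<union> (I \<inter> U - V m))"
  proof (rule measure_mono_fmeasurable)
    show "sym_diff E (V m) \<subseteq> (I \<inter> U - E) \<union> (I \<inter> U - V m)"
      using E U VI[of m] VU[of m] unfolding I_def[symmetric] by blast
    show "(I \<inter> U - E) \<union> (I \<inter> U - V m) \<in> fmeasurable lborel"
      using I U E Vb by (intro fm) auto
  qed (use E Vb in auto)
  also have "\<dots> \<le> measure lborel (I \<inter> U - E) + measure lborel (I \<inter> U - V m)"
    using I U E Vb by (intro measure_Un_le) auto
  also have "\<dots> < e" using UE UV by linarith
  finally show ?thesis using that[of "J m" m] by (auto simp: V_def J_def)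
qed

text \<open>The difference between a set and a finite union of dyadic cells has a small neighbourhood,
  so the Calderon-Zygmund decomposition bounds the norm of the difference of the two indicators.
  The density threshold is chosen first and the measure of the difference afterwards.\<close>

lemma centered_indicator_in_closure:
  fixes p n :: int
  assumes D: "A = of_int p * 2 powi n" "L = 2 powi n"
    and E: "E \<in> sets borel" "E \<subseteq> {A..<A + L}"
  shows "(\<lambda>x. indicator E x - measure lborel E / L * indicator {A..<A + L} x)
    \<in> H1_closure (span haar_system)" (is "?h \<in> _")
proof -
  have L: "L > 0" using D by simp
  define I where "I = {A..<A + L}"
  have I: "is_interval I" "bounded I" "measure lborel I = L" "I \<in> sets borel"
    using L by (auto simp: I_def is_interval_co)
  have fm: "X \<in> fmeasurable lborel" if "X \<in> sets borel" "X \<subseteq> I" for X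
    using that emeasure_bounded_finite[OF bounded_subset[OF I(2) that(2)]] by (intro fmeasurableI) auto
  have ii: "integrable lborel (indicator X :: real \<Rightarrow> real)" if "X \<in> sets borel" "X \<subseteq> I" for X
    using fm[OF that] by (auto intro!: integrable_real_indicator simp: fmeasurable_def)
  have hH: "?h \<in> H1"
  proof (rule H1_bounded_support(1)[where I = I and C = 2])
    show "measure lborel I > 0" using I L by simp
    show "?h \<in> borel_measurable borel" using E by measurable
    show "?h x = 0" if "x \<notin> I" for x using that E by (auto simp: I_def indicator_def)
    have "measure lborel E \<le> measure lborel I"
      using E fm[OF I(4)] by (intro measure_mono_fmeasurable) (auto simp: I_def)
    then have "measure lborel E / L \<le> 1" "measure lborel E / L \<ge> 0" using I L by auto
    then show "\<bar>?h x\<bar> \<le> 2" for x by (auto simp: indicator_def)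
    have "(LBINT x. ?h x) = measure lborel E - measure lborel E / L * measure lborel I"
      using ii[of E] ii[of I] E I by (subst Bochner_Integration.integral_diff) (auto simp: I_def)
    then show "(LBINT x. ?h x) = 0" using I L by simp
  qed (use I in auto)
  have "\<exists>g \<in> span haar_system \<inter> H1. H1_norm (?h - g) < e" if e: "e > 0" for e
  proof -
    \<comment> \<open>Each of the two terms \<open>2 * \<delta> / \<theta>\<close> and \<open>3 * \<theta> * L\<close> is at most \<open>e / 4\<close>.\<close>
    define \<theta> where "\<theta> = min (1 / 2) (e / (12 * L))"
    define \<delta> where "\<delta> = min (\<theta> * L) (\<theta> * e / 8)"
    have \<theta>: "0 < \<theta>" "\<theta> < 1" "3 * \<theta> * L \<le> e / 4"
    proof -
      show "0 < \<theta>" "\<theta> < 1" using e L by (auto simp: \<theta>_def)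
      have "\<theta> \<le> e / (12 * L)" by (simp add: \<theta>_def)
      then show "3 * \<theta> * L \<le> e / 4" using L by (simp add: field_simps)
    qed
    have \<delta>: "0 < \<delta>" "\<delta> \<le> \<theta> * L" "2 * \<delta> / \<theta> \<le> e / 4"
    proof -
      show "0 < \<delta>" "\<delta> \<le> \<theta> * L" using e L \<theta> by (auto simp: \<delta>_def)
      have "\<delta> \<le> \<theta> * e / 8" by (simp add: \<delta>_def)
      then show "2 * \<delta> / \<theta> \<le> e / 4" using \<theta> by (simp add: field_simps)
    qed
    obtain m J where J: "J \<subseteq> {..<2 ^ m}"
      and small: "measure lborel (sym_diff E (\<Union>k\<in>J. cell A L m k)) < \<delta> / 2"
      by (rule dyadic_approximation[OF L E half_gt_zero[OF \<delta>(1)]])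
    have Jfin: "finite J" using J finite_subset by blast
    define V where "V = (\<Union>k\<in>J. cell A L m k)"
    have V: "V \<in> sets borel" "V \<subseteq> I"
    proof -
      show "V \<in> sets borel" unfolding V_def using Jfin cell_interval(3) by auto
      show "V \<subseteq> I" unfolding V_def I_def using J cell_subset[OF L] by blast
    qed
    define F where "F = sym_diff E V"
    have F: "F \<in> sets borel" "F \<subseteq> I" using V E by (auto simp: F_def I_def)
    obtain U where U: "open U" "F \<subseteq> U" "emeasure lborel (U - F) < \<delta> / 2"
      using outer_regular_lborel[OF F(1), of "\<delta> / 2"] \<delta> by auto
    have UI: "measure lborel (U \<inter> I) \<le> \<delta>"
    proof -
      have fin: "emeasure lborel (U - F) < \<infinity>" using U(3) by (rule order_less_trans) simp
      then have UF: "U - F \<in> fmeasurable lborel" using U F by (intro fmeasurableI) auto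
      then have "measure lborel (U - F) < \<delta> / 2"
        using U(3) \<delta> by (simp add: emeasure_eq_measure2 ennreal_less_iff)
      moreover have "measure lborel (U \<inter> I) \<le> measure lborel (F \<union> (U - F))"
      proof (rule measure_mono_fmeasurable)
        show "F \<union> (U - F) \<in> fmeasurable lborel" using fm[OF F] UF by (rule fmeasurable.Un)
      qed (use U I in auto)
      moreover have "measure lborel (F \<union> (U - F)) \<le> measure lborel F + measure lborel (U - F)"
        using F U by (intro measure_Un_le) auto
      ultimately show ?thesis using small by (simp add: F_def V_def)
    qed
    define u where "u = (\<lambda>x. indicator E x - indicator V x :: real)"
    define v where "v = (\<lambda>x. u x - (LBINT x. u x) / L * indicator {A..<A + L} x)"
    have "H1_norm v \<le> 2 * \<delta> / \<theta> + 3 * \<theta> * L"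
      unfolding v_def
    proof (rule H1_norm_small_support(2)[OF L U(1) \<theta>(1,2) _ \<delta>(2)])
      show "measure lborel (U \<inter> {A..<A + L}) \<le> \<delta>" using UI by (simp add: I_def)
      show "u \<in> borel_measurable borel" unfolding u_def using E V by measurable
      show "\<bar>u x\<bar> \<le> 1" for x by (auto simp: u_def indicator_def)
      show "u x = 0" if "x \<notin> U \<inter> {A..<A + L}" for x
      proof -
        have "x \<notin> F" using that U(2) F(2) by (auto simp: I_def)
        then show ?thesis by (auto simp: u_def F_def indicator_def)
      qed
    qed
    then have small_v: "H1_norm v < e" using \<theta>(3) \<delta>(3) e by linarith
    define G where
      "G = (\<Sum>k\<in>J. (\<lambda>x. indicator (cell A L m k) x - 1 / 2 ^ m * indicator {A..<A + L} x :: real))"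
    have G: "G \<in> span haar_system"
      unfolding G_def using J by (intro span_sum centered_cell_in_span[OF D]) auto
    have "?h - G = v"
    proof
      fix x
      have Vsum: "indicator V x = (\<Sum>k\<in>J. indicator (cell A L m k) x :: real)" for x
        unfolding V_def by (rule indicator_UN_disjoint[OF Jfin cell_disjoint[OF L]])
      have "measure lborel V = (\<Sum>k\<in>J. measure lborel (cell A L m k))"
        unfolding V_def
      proof (rule measure_UNION'[OF Jfin])
        show "cell A L m k \<in> fmeasurable lborel" if "k \<in> J" for k
          using that J cell_subset[OF L, of k m A] cell_interval(3) by (intro fm) (auto simp: I_def)
        show "pairwise (\<lambda>i j. disjnt (cell A L m i) (cell A L m j)) J"
          using cell_disjoint[OF L, of A m J] by (auto simp: pairwise_def disjnt_def disjoint_family_on_def)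
      qed
      then have mV: "measure lborel V = real (card J) * (L / 2 ^ m)" by (simp add: measure_cell[OF L])
      have "(LBINT x. u x) = measure lborel E - measure lborel V"
        unfolding u_def using ii[of E] ii[OF V] E V
        by (subst Bochner_Integration.integral_diff) (auto simp: I_def)
      then have vx: "v x = indicator E x - indicator V x
          - (measure lborel E - real (card J) * (L / 2 ^ m)) / L * indicator {A..<A + L} x"
        by (simp add: v_def u_def mV)
      have Gx: "G x = indicator V x - real (card J) / 2 ^ m * indicator {A..<A + L} x"
        by (simp add: G_def sum_fun_apply sum_subtractf Vsum)
      have q: "(measure lborel E - real (card J) * (L / 2 ^ m)) / L
          = measure lborel E / L - real (card J) / 2 ^ m"
        using L by (simp add: diff_divide_distrib)
      show "(?h - G) x = v x" unfolding minus_apply vx Gx q by (simp add: left_diff_distrib)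
    qed
    then show ?thesis using G small_v span_haar_subset_H1 by auto
  qed
  then show ?thesis using hH by (simp add: H1_closure_def)
qed

lemma subspace_haar_closure: "subspace (H1_closure (span haar_system))"
  by (rule subspace_H1_closure) simp

text \<open>Uniform approximation by simple functions reduces bounded functions to indicators. On a fixed
  interval it is enough: a mean zero function supported there and bounded by a small constant is a
  small multiple of an atom.\<close>

lemma bounded_mean_zero_in_closure:
  fixes p n :: int and h :: "real \<Rightarrow> real"
  assumes D: "A = of_int p * 2 powi n" "L = 2 powi n"
    and h: "h \<in> borel_measurable borel" "\<And>x. x \<notin> {A..<A + L} \<Longrightarrow> h x = 0" "\<And>x. \<bar>h x\<bar> \<le> C"
    and zero: "(LBINT x. h x) = 0"
  shows "h \<in> H1_closure (span haar_system)"
proof -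
  have L: "L > 0" using D by simp
  define I where "I = {A..<A + L}"
  have I: "is_interval I" "bounded I" "measure lborel I = L" "I \<in> sets borel"
    using L by (auto simp: I_def is_interval_co)
  have h2: "h x = 0" if "x \<notin> I" for x using h(2) that by (simp add: I_def)
  have pos: "measure lborel I > 0" using I L by simp
  have hH: "h \<in> H1" by (rule H1_bounded_support(1)[OF I(1,2) pos h(1) h2 h(3) zero])
  show ?thesis
  proof (rule H1_closure_closed[OF hH])
    fix e :: real assume e: "e > 0"
    define \<eta> where "\<eta> = e / (4 * L)"
    have \<eta>: "\<eta> > 0" using e L by (simp add: \<eta>_def)
    define E where "E i = {x \<in> I. \<lfloor>h x / \<eta>\<rfloor> = i}" for i :: int
    define N where "N = \<lceil>C / \<eta>\<rceil> + 1"
    have N: "\<lfloor>h x / \<eta>\<rfloor> \<in> {- N..N}" for x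
    proof -
      have "\<bar>h x / \<eta>\<bar> \<le> C / \<eta>" using h(3)[of x] \<eta> by (simp add: abs_divide divide_right_mono)
      also have "C / \<eta> \<le> of_int N - 1" by (simp add: N_def)
      finally have "- of_int N \<le> h x / \<eta>" "h x / \<eta> < of_int N + 1" by linarith+
      then show ?thesis by (simp add: le_floor_iff floor_le_iff)
    qed
    have E: "E i \<in> sets borel" "E i \<subseteq> {A..<A + L}" for i
    proof -
      have "E i = I \<inter> {x. of_int i \<le> h x / \<eta> \<and> h x / \<eta> < of_int i + 1}"
        by (auto simp: E_def floor_eq_iff)
      moreover have "{x. of_int i \<le> h x / \<eta> \<and> h x / \<eta> < of_int i + 1} \<in> sets borel"
        using h(1) by measurable
      ultimately show "E i \<in> sets borel" using I by auto
      show "E i \<subseteq> {A..<A + L}" by (auto simp: E_def I_def)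
    qed
    define g where "g = (\<Sum>i\<in>{- N..N}. (of_int i * \<eta>) *\<^sub>R
      (\<lambda>x. indicator (E i) x - measure lborel (E i) / L * indicator {A..<A + L} x :: real))"
    have g: "g \<in> H1_closure (span haar_system)"
      unfolding g_def
      by (intro subspace_sum[OF subspace_haar_closure] subspace_scale[OF subspace_haar_closure]
          centered_indicator_in_closure[OF D E])
    have gH: "g \<in> H1" using g H1_closure_subset by blast
    \<comment> \<open>On the interval \<open>h - g\<close> is the rounding error \<open>r\<close> plus the constant \<open>c\<close>, which is at most
      \<open>\<eta>\<close> in absolute value because \<open>h - g\<close> has mean zero.\<close>
    define c where "c = (\<Sum>i\<in>{- N..N}. of_int i * \<eta> * (measure lborel (E i) / L))"
    define r where "r = (\<lambda>x. h x - \<eta> * of_int \<lfloor>h x / \<eta>\<rfloor>)"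
    have gx: "g x = (h x - r x) - c * indicator I x" for x
    proof -
      have "(\<Sum>i\<in>{- N..N}. of_int i * \<eta> * indicator (E i) x) = \<eta> * of_int \<lfloor>h x / \<eta>\<rfloor>"
      proof (cases "x \<in> I")
        case True
        then have "(\<Sum>i\<in>{- N..N}. of_int i * \<eta> * indicator (E i) x)
            = (\<Sum>i\<in>{- N..N}. if i = \<lfloor>h x / \<eta>\<rfloor> then of_int i * \<eta> else 0)"
          by (intro sum.cong) (auto simp: E_def indicator_def)
        then show ?thesis using N[of x] by (simp add: sum.delta)
      next
        case False
        then show ?thesis using h2[of x] by (simp add: E_def)
      qed
      then show ?thesis
        by (simp add: g_def sum_fun_apply r_def c_def right_diff_distrib sum_subtractf
            sum_distrib_right I_def mult.assoc)
    qed
    have r: "\<bar>r x\<bar> \<le> \<eta>" "x \<notin> I \<Longrightarrow> r x = 0" for x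
    proof -
      have "\<bar>h x / \<eta> - of_int \<lfloor>h x / \<eta>\<rfloor>\<bar> \<le> 1" by linarith
      then have "\<eta> * \<bar>h x / \<eta> - of_int \<lfloor>h x / \<eta>\<rfloor>\<bar> \<le> \<eta>"
        using \<eta> by (simp add: mult_left_le)
      moreover have "r x = \<eta> * (h x / \<eta> - of_int \<lfloor>h x / \<eta>\<rfloor>)"
        using \<eta> by (simp add: r_def right_diff_distrib)
      ultimately show "\<bar>r x\<bar> \<le> \<eta>" using \<eta> by (simp only: abs_mult)
      show "r x = 0" if "x \<notin> I" using h2[OF that] by (simp add: r_def)
    qed
    have rm: "r \<in> borel_measurable borel" unfolding r_def using h(1) by measurable
    have ri: "integrable lborel r" by (rule integrable_bounded_support[OF rm I(4,2) r(2,1)])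
    have int0: "(LBINT x. (h - g) x) = 0"
      using H1_integral_zero[OF H1_diff(1)[OF hH gH]] .
    have c: "\<bar>c\<bar> \<le> \<eta>"
    proof -
      have "(LBINT x. (h - g) x) = (LBINT x. r x + c * indicator I x)" by (simp add: gx)
      also have "\<dots> = (LBINT x. r x) + c * L"
        using ri I emeasure_bounded_finite[OF I(2)]
        by (subst Bochner_Integration.integral_add)
           (auto intro!: integrable_mult_right integrable_real_indicator)
      finally have "c * L = - (LBINT x. r x)" using int0 by linarith
      then have "\<bar>c\<bar> * L = \<bar>LBINT x. r x\<bar>" using L by (metis abs_minus_cancel abs_mult abs_of_pos)
      also have "\<dots> \<le> (LBINT x. \<bar>r x\<bar>)" by (rule integral_abs_bound)
      also have "\<dots> \<le> \<eta> * L"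
        using integral_abs_bounded_support[OF rm I(4,2) r(2,1)] I(3) by simp
      finally show ?thesis using L by simp
    qed
    have "H1_norm (h - g) \<le> (2 * \<eta>) * measure lborel I"
    proof (rule H1_bounded_support(2)[OF I(1,2) pos _ _ _ int0])
      show "h - g \<in> borel_measurable borel" by (rule H1_measurable[OF H1_diff(1)[OF hH gH]])
      show "(h - g) x = 0" if "x \<notin> I" for x using that r(2)[OF that] by (simp add: gx)
      show "\<bar>(h - g) x\<bar> \<le> 2 * \<eta>" for x
        using r(1)[of x] c by (auto simp: gx indicator_def)
    qed
    also have "\<dots> < e" using e L I(3) by (simp add: \<eta>_def)
    finally show "\<exists>g \<in> H1_closure (span haar_system). H1_norm (h - g) < e" using g by blast
  qed
qed

section \<open>The closed span of the Haar system\<close>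

text \<open>A dyadic interval lies on one side of the origin.\<close>

lemma haar_in_HA:
  assumes I: "I \<in> dyadic_intervals"
  shows "haar I \<in> HA"
proof -
  obtain k n :: int where I': "I = {of_int k * 2 powi n ..< (of_int k + 1) * 2 powi n}"
    using I by (auto simp: dyadic_intervals_def)
  have cell: "I = cell (of_int k * 2 powi n) (2 powi n) 0 0"
    by (simp add: I' cell_def algebra_simps)
  have supp: "haar I x = 0" if "x \<notin> I" for x
  proof -
    have "x \<notin> cell (of_int k * 2 powi n) (2 powi n) (Suc 0) (2 * 0)"
      "x \<notin> cell (of_int k * 2 powi n) (2 powi n) (Suc 0) (2 * 0 + 1)"
      using that cell_parent[of "2 powi n" "of_int k * 2 powi n" 0 0]
        cell_parent[of "2 powi n" "of_int k * 2 powi n" 0 1] unfolding cell by auto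
    then show ?thesis unfolding cell by (subst haar_cell) auto
  qed
  have "(LBINT x:{0..}. haar I x) = 0"
  proof (cases "k \<ge> 0")
    case True
    have "x \<ge> 0" if "x \<in> I" for x
      using that True unfolding I' by (auto intro: order_trans[rotated])
    then have "(\<lambda>x. indicator {0..} x *\<^sub>R haar I x) = haar I"
      using supp by (auto simp: fun_eq_iff indicator_def)
    then show ?thesis
      using H1_integral_zero[OF haar_in_H1[OF I]] by (simp add: set_lebesgue_integral_def)
  next
    case False
    have "x < 0" if "x \<in> I" for x
    proof -
      have "(of_int k + 1) * 2 powi n \<le> (0::real)"
        using False by (intro mult_nonpos_nonneg) auto
      then show ?thesis using that unfolding I' by auto
    qed
    then have "haar I x = 0" if "x \<ge> 0" for x using that by (intro supp) force
    then have "(\<lambda>x. indicator {0..} x *\<^sub>R haar I x) = (\<lambda>x. 0)"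
      by (auto simp: fun_eq_iff indicator_def)
    then show ?thesis by (simp add: set_lebesgue_integral_def)
  qed
  then show ?thesis using haar_in_H1[OF I] by (simp add: HA_def)
qed

lemma H1_set_integrable: "f \<in> H1 \<Longrightarrow> S \<in> sets borel \<Longrightarrow> set_integrable lborel S f"
  unfolding set_integrable_def by (intro integrable_mult_indicator) (auto dest: H1_integrable)

lemma subspace_HA: "subspace HA"
proof (rule subspaceI)
  show "0 \<in> HA" using subspace_0[OF subspace_H1] by (simp add: HA_def set_lebesgue_integral_def)
  show "f + g \<in> HA" if "f \<in> HA" "g \<in> HA" for f g
  proof -
    have "f \<in> H1" "g \<in> H1" using that by (auto simp: HA_def)
    moreover from this
    have "set_lebesgue_integral lborel {0..} (f + g) = (LBINT x:{0..}. f x) + (LBINT x:{0..}. g x)"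
      unfolding plus_fun_def by (intro set_integral_add(2) H1_set_integrable) auto
    ultimately show ?thesis using that H1_add(1) unfolding HA_def by simp
  qed
  show "c *\<^sub>R f \<in> HA" if "f \<in> HA" for c f
  proof -
    have "set_lebesgue_integral lborel {0..} (c *\<^sub>R f) = c * (LBINT x:{0..}. f x)"
      unfolding scaleR_fun_def by simp
    then show ?thesis using that H1_scaleR(1) unfolding HA_def by simp
  qed
qed

lemma H1_half_line_integral_le:
  assumes f: "f \<in> H1"
  shows "\<bar>LBINT x:{0..}. f x\<bar> \<le> H1_norm f"
proof -
  have "\<bar>LBINT x:{0..}. f x\<bar> \<le> (LBINT x. \<bar>indicator {0..} x *\<^sub>R f x\<bar>)"
    unfolding set_lebesgue_integral_def by (rule integral_abs_bound)
  also have "\<dots> \<le> (LBINT x. \<bar>f x\<bar>)"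
    using H1_integrable[OF f] H1_set_integrable[OF f, of "{0..}"]
    by (intro integral_mono) (auto simp: set_integrable_def indicator_def)
  finally show ?thesis using H1_integral_abs_le[OF f] by linarith
qed

lemma haar_closure_subset_HA: "H1_closure (span haar_system) \<subseteq> HA"
proof
  fix f assume f: "f \<in> H1_closure (span haar_system)"
  then have fH: "f \<in> H1" using H1_closure_subset by blast
  have span: "span haar_system \<subseteq> HA"
    by (rule span_minimal[OF _ subspace_HA]) (auto simp: haar_system_def haar_in_HA)
  have "\<bar>LBINT x:{0..}. f x\<bar> \<le> 0 + e" if e: "e > 0" for e
  proof -
    obtain g where g: "g \<in> span haar_system" "g \<in> H1" "H1_norm (f - g) < e"
      using f e by (auto simp: H1_closure_def)
    have "(LBINT x:{0..}. (f - g) x) = (LBINT x:{0..}. f x) - (LBINT x:{0..}. g x)"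
      unfolding minus_apply using fH g by (intro set_integral_diff(2) H1_set_integrable) auto
    moreover have "(LBINT x:{0..}. g x) = 0" using g(1) span by (auto simp: HA_def)
    ultimately show ?thesis
      using H1_half_line_integral_le[OF H1_diff(1)[OF fH g(2)]] g(3) by simp
  qed
  then have "\<bar>LBINT x:{0..}. f x\<bar> \<le> 0" by (rule field_le_epsilon)
  then show "f \<in> HA" using fH by (simp add: HA_def)
qed

text \<open>A fixed function in \<open>H\<^sup>1\<close> with integral one over the positive half-line. Subtracting a multiple
  of it from an atom makes the integrals over both half-lines vanish.\<close>

definition odd_step :: "real \<Rightarrow> real" where
  "odd_step = (\<lambda>x. indicator {0..<1} x - indicator {-1..<0} x)"

lemma odd_step_in_H1: "odd_step \<in> H1"
  and odd_step_half_line: "(LBINT x:{0..}. odd_step x) = 1"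
proof -
  show "odd_step \<in> H1"
  proof (rule H1_bounded_support(1)[of "{-1..<1}" _ 1])
    show "(LBINT x. odd_step x) = 0"
      unfolding odd_step_def
      by (subst Bochner_Integration.integral_diff) (auto intro!: integrable_real_indicator)
  qed (auto simp: odd_step_def indicator_def is_interval_co)
  have "(\<lambda>x. indicator {0..} x *\<^sub>R odd_step x) = indicator {0..<1}"
    by (auto simp: fun_eq_iff odd_step_def indicator_def)
  then show "(LBINT x:{0..}. odd_step x) = 1" by (simp add: set_lebesgue_integral_def)
qed

text \<open>The corrected atom is bounded with bounded support, and its restrictions to the two half-lines
  are supported in dyadic intervals with endpoint zero and have mean zero.\<close>

lemma corrected_atom_in_closure:
  assumes "is_atom a"
  shows "a - (LBINT x:{0..}. a x) *\<^sub>R odd_step \<in> H1_closure (span haar_system)"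
proof -
  obtain I where I: "atom_on I a" using assms by (auto simp: is_atom_def)
  then have "bounded I" by (simp add: atom_on_def)
  then obtain B where B: "\<And>x. x \<in> I \<Longrightarrow> \<bar>x\<bar> \<le> B" by (auto simp: bounded_iff)
  obtain N where N: "max B 1 < 2 ^ N" using real_arch_pow[of 2 "max B 1"] by auto
  define c where "c = (LBINT x:{0..}. a x)"
  define h where "h = a - c *\<^sub>R odd_step"
  have ai: "integrable lborel a" "(LBINT x. a x) = 0" using atom_on_integral[OF I] by auto
  have oi: "integrable lborel odd_step" "(LBINT x. odd_step x) = 0"
    using odd_step_in_H1 by (auto intro: H1_integrable H1_integral_zero)
  have hi: "integrable lborel h" unfolding h_def fun_diff_def scaleR_fun_apply using ai oi by simp
  have h0: "(LBINT x. h x) = 0" unfolding h_def using ai oi by simp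
  have hm: "h \<in> borel_measurable borel" using borel_measurable_integrable[OF hi] by simp
  have hp: "(LBINT x:{0..}. h x) = 0"
  proof -
    have "set_integrable lborel {0..} a"
      unfolding set_integrable_def using ai by (intro integrable_mult_indicator) auto
    then show ?thesis
      unfolding h_def minus_apply scaleR_fun_apply
      using H1_set_integrable[OF odd_step_in_H1, of "{0..}"] odd_step_half_line
      by (simp add: c_def set_integral_diff(2))
  qed
  have hbd: "\<bar>h x\<bar> \<le> 1 / interval_length I + \<bar>c\<bar>" for x
  proof -
    have "\<bar>a x\<bar> \<le> 1 / interval_length I" using I by (simp add: atom_on_def)
    moreover have "\<bar>c * odd_step x\<bar> \<le> \<bar>c\<bar>" by (auto simp: odd_step_def indicator_def)
    ultimately show ?thesis unfolding h_def using abs_triangle_ineq4[of "a x" "c * odd_step x"] by simp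
  qed
  have hout: "h x = 0" if "x \<notin> {- (2 ^ N)..<2 ^ N}" for x
  proof -
    have "\<bar>x\<bar> \<ge> 2 ^ N" using that by auto
    then have "\<bar>x\<bar> > B" "\<bar>x\<bar> > 1" using N by linarith+
    then have "x \<notin> I" "odd_step x = 0" using B[of x] by (auto simp: odd_step_def indicator_def)
    then show ?thesis using I by (auto simp: h_def atom_on_def)
  qed
  define p where "p = (\<lambda>x. indicator {0..} x * h x)"
  define q where "q = (\<lambda>x. indicator {..<0} x * h x)"
  have pq: "h = p + q" by (auto simp: fun_eq_iff p_def q_def indicator_def)
  have pi: "integrable lborel p" "integrable lborel q"
    unfolding p_def q_def using hi by (auto intro!: integrable_real_mult_indicator simp: mult.commute[of "indicator _ _"])
  have p0: "(LBINT x. p x) = 0" using hp by (simp add: p_def set_lebesgue_integral_def)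
  have q0: "(LBINT x. q x) = 0" using h0 p0 pi by (simp add: pq)
  have "p \<in> H1_closure (span haar_system)"
  proof (rule bounded_mean_zero_in_closure[where A = 0 and L = "2 ^ N" and p = 0 and n = "int N"])
    show "p \<in> borel_measurable borel" using borel_measurable_integrable[OF pi(1)] by simp
    show "p x = 0" if "x \<notin> {0..<0 + 2 ^ N}" for x
      using that hout[of x] by (auto simp: p_def indicator_def)
    show "\<bar>p x\<bar> \<le> 1 / interval_length I + \<bar>c\<bar>" for x
      using hbd[of x] by (auto simp: p_def indicator_def)
  qed (use p0 in auto)
  moreover have "q \<in> H1_closure (span haar_system)"
  proof (rule bounded_mean_zero_in_closure[where A = "- (2 ^ N)" and L = "2 ^ N" and p = "-1" and n = "int N"])
    show "q \<in> borel_measurable borel" using borel_measurable_integrable[OF pi(2)] by simp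
    show "q x = 0" if "x \<notin> {- (2 ^ N)..<- (2 ^ N) + 2 ^ N}" for x
      using that hout[of x] by (auto simp: q_def indicator_def)
    show "\<bar>q x\<bar> \<le> 1 / interval_length I + \<bar>c\<bar>" for x
      using hbd[of x] by (auto simp: q_def indicator_def)
  qed (use q0 in auto)
  ultimately have "h \<in> H1_closure (span haar_system)"
    unfolding pq by (rule subspace_add[OF subspace_haar_closure])
  then show ?thesis by (simp add: h_def c_def)
qed

text \<open>The remainder of an atomic decomposition is decomposed by the remaining atoms.\<close>

lemma H1_norm_tail:
  assumes f: "f \<in> H1" and d: "atomic_decomposition f l a"
  shows "f - (\<Sum>j<n. l j *\<^sub>R a j) \<in> H1" "H1_norm (f - (\<Sum>j<n. l j *\<^sub>R a j)) \<le> (\<Sum>j. \<bar>l (j + n)\<bar>)"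
proof -
  note D = atomic_decompositionD[OF d]
  have sum: "(\<Sum>j<n. l j *\<^sub>R a j) x = (\<Sum>j<n. l j * a j x)" for x n by (simp add: sum_fun_apply)
  have i: "integrable lborel (f - (\<Sum>j<n. l j *\<^sub>R a j))"
    unfolding fun_diff_def sum
    using H1_integrable[OF f] partial_sum_integrable[OF D(1)] by (rule Bochner_Integration.integrable_diff)
  have "atomic_decomposition (f - (\<Sum>j<n. l j *\<^sub>R a j)) (\<lambda>j. l (j + n)) (\<lambda>j. a (j + n))"
  proof (rule atomic_decompositionI[OF i])
    show "is_atom (a (j + n))" for j by (rule D)
    show "summable (\<lambda>j. \<bar>l (j + n)\<bar>)" using D(2) by (subst summable_iff_shift)
    have "(f - (\<Sum>j<n. l j *\<^sub>R a j)) x - (\<Sum>j<m. l (j + n) * a (j + n) x)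
        = f x - (\<Sum>j<m + n. l j * a j x)" for m x
      unfolding minus_apply sum
      by (induction m) (simp_all add: algebra_simps)
    moreover have "(\<lambda>m. LBINT x. \<bar>f x - (\<Sum>j<m + n. l j * a j x)\<bar>) \<longlonglongrightarrow> 0"
      using D(3) by (rule LIMSEQ_ignore_initial_segment)
    ultimately show "(\<lambda>m. LBINT x. \<bar>(f - (\<Sum>j<n. l j *\<^sub>R a j)) x - (\<Sum>j<m. l (j + n) * a (j + n) x)\<bar>) \<longlonglongrightarrow> 0"
      by (simp only:)
  qed
  then show "f - (\<Sum>j<n. l j *\<^sub>R a j) \<in> H1" "H1_norm (f - (\<Sum>j<n. l j *\<^sub>R a j)) \<le> (\<Sum>j. \<bar>l (j + n)\<bar>)"
    using i H1I H1_norm_le by blast+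
qed

text \<open>The corrected partial sums of an atomic decomposition still converge, because the corrections
  are the integrals of the partial sums over the half-line, which tend to that of the limit.\<close>

lemma HA_subset_haar_closure: "HA \<subseteq> H1_closure (span haar_system)"
proof
  fix f assume "f \<in> HA"
  then have f: "f \<in> H1" and f0: "(LBINT x:{0..}. f x) = 0" by (auto simp: HA_def)
  obtain l a where d: "atomic_decomposition f l a" using f by (auto simp: H1_def)
  note D = atomic_decompositionD[OF d]
  define s where "s n = (LBINT x:{0..}. (\<Sum>j<n. l j * a j x))" for n
  have s: "s n = (\<Sum>j<n. l j * (LBINT x:{0..}. a j x))" for n
  proof -
    have "integrable lborel (\<lambda>x. l j * (indicator {0..} x *\<^sub>R a j x))" for j
      using atom_integrable[OF D(1)] by (intro integrable_mult_right integrable_mult_indicator) auto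
    note int = this
    have "indicator {0..} x *\<^sub>R (\<Sum>j<n. l j * a j x)
        = (\<Sum>j<n. l j * (indicator {0..} x *\<^sub>R a j x))" for x
      by (simp add: sum_distrib_left mult.left_commute del: sum_mult_indicator)
    then have "s n = (LBINT x. (\<Sum>j<n. l j * (indicator {0..} x *\<^sub>R a j x)))"
      unfolding s_def set_lebesgue_integral_def by (simp only:)
    also have "\<dots> = (\<Sum>j<n. LBINT x. l j * (indicator {0..} x *\<^sub>R a j x))"
      using int by (rule Bochner_Integration.integral_sum)
    finally show ?thesis by (simp only: integral_mult_right_zero set_lebesgue_integral_def)
  qed
  have s0: "s \<longlonglongrightarrow> 0"
    unfolding s_def using set_integral_tendsto_L1[OF H1_integrable[OF f] partial_sum_integrable[OF D(1)] _ D(3), of "{0..}"] f0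
    by simp
  have tail: "(\<lambda>n. \<Sum>j. \<bar>l (j + n)\<bar>) \<longlonglongrightarrow> 0" using D(2) by (rule suminf_exist_split2)
  show "f \<in> H1_closure (span haar_system)"
  proof (rule H1_closure_closed[OF f])
    fix e :: real assume e: "e > 0"
    have "(\<lambda>n. (\<Sum>j. \<bar>l (j + n)\<bar>) + \<bar>s n\<bar> * H1_norm odd_step) \<longlonglongrightarrow> 0 + \<bar>0\<bar> * H1_norm odd_step"
      by (intro tendsto_intros tail s0)
    then have "eventually (\<lambda>n. (\<Sum>j. \<bar>l (j + n)\<bar>) + \<bar>s n\<bar> * H1_norm odd_step < e) sequentially"
      using e by (intro order_tendstoD(2)) auto
    then obtain n where n: "(\<Sum>j. \<bar>l (j + n)\<bar>) + \<bar>s n\<bar> * H1_norm odd_step < e"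
      by (auto simp: eventually_sequentially)
    define P where "P = (\<Sum>j<n. l j *\<^sub>R (a j - (LBINT x:{0..}. a j x) *\<^sub>R odd_step))"
    have P: "P \<in> H1_closure (span haar_system)"
      unfolding P_def
      by (intro subspace_sum[OF subspace_haar_closure] subspace_scale[OF subspace_haar_closure]
          corrected_atom_in_closure D)
    have eq: "f - P = (f - (\<Sum>j<n. l j *\<^sub>R a j)) + s n *\<^sub>R odd_step"
      by (auto simp: fun_eq_iff P_def sum_fun_apply s right_diff_distrib sum_subtractf
          sum_distrib_right mult.assoc)
    have "H1_norm (f - P) \<le> (\<Sum>j. \<bar>l (j + n)\<bar>) + \<bar>s n\<bar> * H1_norm odd_step"
      unfolding eq
      using H1_add(2)[OF H1_norm_tail(1)[OF f d] H1_scaleR(1)[OF odd_step_in_H1]]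
        H1_norm_tail(2)[OF f d, of n] H1_scaleR(2)[OF odd_step_in_H1, of "s n"]
      by (meson add_mono order_trans)
    then show "\<exists>h \<in> H1_closure (span haar_system). H1_norm (f - h) < e" using P n by force
  qed
qed

theorem theorem2p1:
  shows "H1_closure (span haar_system) = HA"
  using haar_closure_subset_HA HA_subset_haar_closure by (rule subset_antisym)

end
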